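(* (1) For each billiard $P_1'P_2'\dots$ in an ellipse $e'$ with an ellipse $c'$ as caustic there exists an isometric billiard $P_1''P_2''\dots$ in an ellipse $e''$ with a hyperbola $c''$ as caustic. The billiard inscribed in $e''$ is unique only up to a reflection in the principal axis. (2) Conversely, for each billiard with a hyperbola $c''$ as caustic there exists an isometric billiard with an ellipse $c'$ as caustic, provided that in the case of an $N$-periodic billiard with $N\equiv 2\pmod 4$, we traverse the billiard with the elliptic caustic twice. (3) For each side $P_i'P_{i+1}'$ of the original billiard, the isometry $[P_i',P_{i+1}']\to[P_i'',P_{i+1}'']$ between the extended sides maps the incident points $S_k^{(j)\prime}$ with $j\equiv 0\pmod 2$ of the associated Poncelet grid to the corresponding points $S_k^{(j)\prime\prime}$ of the isometric billiard, hence $$\overline{P_i''S_k^{(j)\prime\prime}}=\overline{P_i'S_k^{(j)\prime}}\quad\text{for}\quad k=i+\tfrac j2 .$$ (4) For all $i$, the isometric image of the contact point $Q_i'$ of the side $P_i'P_{i+1}'$ with the ellipse $c'$ is the point of intersection $Q_i''$ of the side $P_i''P_{i+1}''$ with the principal axis. On the other hand, the isometry sends the point of intersection $T_i'$ between the side line $[P_i',P_{i+1}']$ and the principal axis to the contact point $T_i''$ of the side $P_i''P_{i+1}''$ with the hyperbola $c''$.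
   Context: $[A,B]$ denotes the line through $A$ and $B$, and $\overline{AB}$ the distance of $A$ and $B$. A billiard in an ellipse $e$ is the trajectory $\dots P_1P_2P_3\dots$ of a mass point inside $e$ with ideal physical reflections at the vertices $P_i\in e$. Its side lines $[P_i,P_{i+1}]$ are tangent to a conic confocal with $e$, called the caustic. The billiard is $N$-periodic if $P_{i+N}=P_i$ for all $i$. The principal axis of an ellipse or hyperbola is its axis of symmetry containing the foci. Two polygons $P_1P_2\dots$ and $P_1^*P_2^*\dots$ in Euclidean 3-space are called isometric if corresponding sides $P_iP_{i+1}$ and $P_i^*P_{i+1}^*$ have equal lengths for all $i$. The isometry between the extended sides $[P_i',P_{i+1}']$ and $[P_i'',P_{i+1}'']$ is the one with $P_i'\mapsto P_i''$ and $P_{i+1}'\mapsto P_{i+1}''$. The points $S_i^{(j)}$ of the Poncelet grid associated with a billiard $\dots P_1P_2P_3\dots$ are intersections of extended sides; for even $j=2m$, $S_i^{(j)}=[P_{i-m-1},P_{i-m}]\cap[P_{i+m},P_{i+m+1}]$. Single primes refer to the billiard with the elliptic caustic $c'$, double primes to the billiard with the hyperbolic caustic $c''$.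
   Formalization: e' non-circular; asymptotes count as tangents; uniqueness also allows the half-turn of e'' and, if 4-periodic, reversed order; for N≡2 mod 4 the elliptic billiard is traversed twice only if opposite vertices mirror in the principal axis; grid points need distinct lines in both. *)

theory Defs
  imports "HOL-Analysis.Analysis"
begin

text \<open>
  The Euclidean plane is the type \<^typ>\<open>complex\<close>. An ellipse or hyperbola in arbitrary position is
  given by its centre, a unit vector spanning its principal axis, and two numbers \<open>A\<close>, \<open>B\<close>
  such that its equation is \<open>x\<^sup>2/A + y\<^sup>2/B = 1\<close> in the coordinates of this frame. For \<open>0 < B < A\<close> this
  is an ellipse with semiaxes \<open>\<surd>A\<close>, \<open>\<surd>B\<close> (no circle), for \<open>B < 0 < A\<close> a hyperbola; in both cases the
  foci lie on the x-axis of the frame at distance \<open>\<surd>(A - B)\<close> from the centre.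
\<close>

record conic =
  centre :: complex
  axis_dir :: complex
  sqA :: real
  sqB :: real

definition xc :: "conic \<Rightarrow> complex \<Rightarrow> real" where
  "xc C X = inner (X - centre C) (axis_dir C)"

definition yc :: "conic \<Rightarrow> complex \<Rightarrow> real" where
  "yc C X = inner (X - centre C) (\<i> * axis_dir C)"

definition is_ellipse :: "conic \<Rightarrow> bool" where
  "is_ellipse C \<longleftrightarrow> norm (axis_dir C) = 1 \<and> 0 < sqB C \<and> sqB C < sqA C"

definition is_hyperbola :: "conic \<Rightarrow> bool" where
  "is_hyperbola C \<longleftrightarrow> norm (axis_dir C) = 1 \<and> sqB C < 0 \<and> 0 < sqA C"

definition points :: "conic \<Rightarrow> complex set" where
  "points C = {X. (xc C X)\<^sup>2 / sqA C + (yc C X)\<^sup>2 / sqB C = 1}"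

definition foci :: "conic \<Rightarrow> complex set" where
  "foci C = {centre C + sqrt (sqA C - sqB C) *\<^sub>R axis_dir C,
             centre C - sqrt (sqA C - sqB C) *\<^sub>R axis_dir C}"

definition confocal :: "conic \<Rightarrow> conic \<Rightarrow> bool" where
  "confocal C D \<longleftrightarrow> foci C = foci D"

definition principal_axis :: "conic \<Rightarrow> complex set" where
  "principal_axis C = affine hull (foci C)"

definition axis_reflection :: "conic \<Rightarrow> complex \<Rightarrow> complex" where
  "axis_reflection C X = centre C + xc C X *\<^sub>R axis_dir C - yc C X *\<^sub>R (\<i> * axis_dir C)"

definition half_turn :: "conic \<Rightarrow> complex \<Rightarrow> complex" where
  "half_turn C X = 2 * centre C - X"

definition tangent_at :: "conic \<Rightarrow> complex \<Rightarrow> complex set" where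
  "tangent_at C T = {X. xc C T * xc C X / sqA C + yc C T * yc C X / sqB C = 1}"

definition touches :: "conic \<Rightarrow> complex set \<Rightarrow> complex \<Rightarrow> bool" where
  "touches C L T \<longleftrightarrow> T \<in> points C \<and> L = tangent_at C T"

definition asymptotes :: "conic \<Rightarrow> complex set set" where
  "asymptotes C = (if is_hyperbola C
     then {{X. xc C X / sqrt (sqA C) = s * (yc C X / sqrt (- sqB C))} | s. s \<in> {1, - 1}}
     else {})"

text \<open>
  A side line through the centre can only touch a hyperbolic caustic at infinity, so asymptotes
  count as tangents, as in projective geometry.
\<close>

definition tangent_line :: "conic \<Rightarrow> complex set \<Rightarrow> bool" where
  "tangent_line C L \<longleftrightarrow> (\<exists>T. touches C L T) \<or> L \<in> asymptotes C"

text \<open>A normal vector of the conic at its point \<open>X\<close> (half the gradient of the equation).\<close>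

definition normal_vec :: "conic \<Rightarrow> complex \<Rightarrow> complex" where
  "normal_vec C X = (xc C X / sqA C) *\<^sub>R axis_dir C + (yc C X / sqB C) *\<^sub>R (\<i> * axis_dir C)"

text \<open>Reflection of a vector in the line orthogonal to \<open>n\<close>.\<close>

definition mirror :: "complex \<Rightarrow> complex \<Rightarrow> complex" where
  "mirror n v = v - (2 * inner v n / inner n n) *\<^sub>R n"

definition side_line :: "(int \<Rightarrow> complex) \<Rightarrow> int \<Rightarrow> complex set" where
  "side_line P i = affine hull {P i, P (i + 1)}"

definition billiard :: "conic \<Rightarrow> (int \<Rightarrow> complex) \<Rightarrow> bool" where
  "billiard e P \<longleftrightarrow> is_ellipse e \<and>
     (\<forall>i. P i \<in> points e \<and> P i \<noteq> P (i + 1) \<and>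
          sgn (P (i + 1) - P i) = mirror (normal_vec e (P i)) (sgn (P i - P (i - 1))))"

definition caustic :: "conic \<Rightarrow> conic \<Rightarrow> (int \<Rightarrow> complex) \<Rightarrow> bool" where
  "caustic e c P \<longleftrightarrow> confocal e c \<and> (\<forall>i. tangent_line c (side_line P i))"

definition elliptic_billiard :: "conic \<Rightarrow> conic \<Rightarrow> (int \<Rightarrow> complex) \<Rightarrow> bool" where
  "elliptic_billiard e c P \<longleftrightarrow> billiard e P \<and> is_ellipse c \<and> caustic e c P"

definition hyperbolic_billiard :: "conic \<Rightarrow> conic \<Rightarrow> (int \<Rightarrow> complex) \<Rightarrow> bool" where
  "hyperbolic_billiard e c P \<longleftrightarrow> billiard e P \<and> is_hyperbola c \<and> caustic e c P"

definition periodic :: "(int \<Rightarrow> 'a) \<Rightarrow> nat \<Rightarrow> bool" where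
  "periodic P N \<longleftrightarrow> 0 < N \<and> (\<forall>i. P (i + int N) = P i)"

definition least_period :: "(int \<Rightarrow> 'a) \<Rightarrow> nat \<Rightarrow> bool" where
  "least_period P N \<longleftrightarrow> periodic P N \<and> (\<forall>M. periodic P M \<longrightarrow> N \<le> M)"

definition isometric_polygons ::
    "(int \<Rightarrow> 'a::metric_space) \<Rightarrow> (int \<Rightarrow> 'b::metric_space) \<Rightarrow> bool" where
  "isometric_polygons P P' \<longleftrightarrow> (\<forall>i. dist (P i) (P (i + 1)) = dist (P' i) (P' (i + 1)))"

text \<open>
  The affine map from the \<open>i\<close>-th side line of \<open>P\<close> to that of \<open>P'\<close> with \<open>P i \<mapsto> P' i\<close> and
  \<open>P (i + 1) \<mapsto> P' (i + 1)\<close>; for isometric polygons it is the isometry between these lines. Off the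
  side line of \<open>P\<close> its values are irrelevant.
\<close>

definition side_isometry ::
    "(int \<Rightarrow> complex) \<Rightarrow> (int \<Rightarrow> complex) \<Rightarrow> int \<Rightarrow> complex \<Rightarrow> complex" where
  "side_isometry P P' i X =
     P' i + (inner (X - P i) (P (i + 1) - P i) / (dist (P i) (P (i + 1)))\<^sup>2) *\<^sub>R (P' (i + 1) - P' i)"

lemma side_isometry_vertices:
  assumes "P i \<noteq> P (i + 1)"
  shows "side_isometry P P' i (P i) = P' i" "side_isometry P P' i (P (i + 1)) = P' (i + 1)"
proof -
  have "dist (P i) (P (i + 1)) = norm (P (i + 1) - P i)"
    by (metis dist_commute dist_norm)
  then have "inner (P (i + 1) - P i) (P (i + 1) - P i) / (dist (P i) (P (i + 1)))\<^sup>2 = 1"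
    using assms by (simp add: power2_norm_eq_inner)
  then show "side_isometry P P' i (P (i + 1)) = P' (i + 1)"
    using assms by (simp add: side_isometry_def)
qed (simp add: side_isometry_def)

lemma side_isometry_dist:
  assumes "P i \<noteq> P (i + 1)" "dist (P i) (P (i + 1)) = dist (P' i) (P' (i + 1))"
    and "X \<in> side_line P i" "Y \<in> side_line P i"
  shows "dist (side_isometry P P' i X) (side_isometry P P' i Y) = dist X Y"
proof -
  define d where "d = P (i + 1) - P i"
  have par: "\<exists>t. Z = P i + t *\<^sub>R d" if Z: "Z \<in> side_line P i" for Z
  proof -
    obtain u v where uv: "u + v = 1" and "Z = u *\<^sub>R P i + v *\<^sub>R P (i + 1)"
      using Z unfolding side_line_def affine_hull_2 by blast
    moreover have "u = 1 - v"
      using uv by linarith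
    ultimately have "Z = P i + v *\<^sub>R d"
      by (simp add: d_def scaleR_diff_left scaleR_diff_right)
    then show ?thesis by blast
  qed
  obtain s t where X: "X = P i + s *\<^sub>R d" and Y: "Y = P i + t *\<^sub>R d"
    using par assms by blast
  have d: "d \<noteq> 0" "dist (P i) (P (i + 1)) = norm d" "norm (P' (i + 1) - P' i) = norm d"
    using assms by (auto simp: d_def dist_norm norm_minus_commute)
  have img: "side_isometry P P' i (P i + r *\<^sub>R d) = P' i + r *\<^sub>R (P' (i + 1) - P' i)" for r
    using d by (simp add: side_isometry_def d_def[symmetric] power2_norm_eq_inner)
  have diff: "(a + s *\<^sub>R w) - (a + t *\<^sub>R w) = (s - t) *\<^sub>R w" for a w :: complex
    by (simp add: algebra_simps)
  show ?thesis
    unfolding X Y img dist_norm diff by (simp add: d)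
qed

text \<open>
  \<open>grid_point P k m S\<close>: \<open>S\<close> is the point \<open>S\<^sub>k\<^bsup>(j)\<^esup>\<close> of the Poncelet grid for \<open>j = 2m\<close>. It exists only
  if the two side lines are neither equal nor parallel.
\<close>

definition grid_point :: "(int \<Rightarrow> complex) \<Rightarrow> int \<Rightarrow> nat \<Rightarrow> complex \<Rightarrow> bool" where
  "grid_point P k m S \<longleftrightarrow>
     side_line P (k - int m - 1) \<noteq> side_line P (k + int m) \<and>
     S \<in> side_line P (k - int m - 1) \<inter> side_line P (k + int m)"

text \<open>
  The side lines incident with \<open>S\<^sub>k\<^bsup>(2m)\<^esup>\<close> are those with the indices \<open>k - m - 1\<close> and \<open>k + m\<close>.
  Closed billiards can have coinciding side lines with different indices in only one of the two polygons;
  then the corresponding point is undefined there, whence the extra assumptions.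
\<close>

definition grid_correspondence :: "(int \<Rightarrow> complex) \<Rightarrow> (int \<Rightarrow> complex) \<Rightarrow> bool" where
  "grid_correspondence P P' \<longleftrightarrow>
     (\<forall>k m S. grid_point P k m S \<and> side_line P' (k - int m - 1) \<noteq> side_line P' (k + int m) \<longrightarrow>
        (\<forall>i \<in> {k - int m - 1, k + int m}. grid_point P' k m (side_isometry P P' i S))) \<and>
     (\<forall>k m S'. grid_point P' k m S' \<and> side_line P (k - int m - 1) \<noteq> side_line P (k + int m) \<longrightarrow>
        (\<exists>S. grid_point P k m S)) \<and>
     (\<forall>i k m S S'. k = i + int m \<and> grid_point P k m S \<and> grid_point P' k m S' \<longrightarrow>
        dist (P' i) S' = dist (P i) S)"

text \<open>
  \<open>e\<close>, \<open>c\<close>, \<open>P\<close> belong to the billiard with elliptic caustic, \<open>e'\<close>, \<open>c'\<close>, \<open>P'\<close> to the one with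
  hyperbolic caustic. The equivalence in the last clause includes that a side line of \<open>P\<close> is
  parallel to the principal axis if and only if the side line of \<open>P'\<close> is an asymptote.
\<close>

definition contact_correspondence ::
    "conic \<Rightarrow> conic \<Rightarrow> (int \<Rightarrow> complex) \<Rightarrow> conic \<Rightarrow> conic \<Rightarrow> (int \<Rightarrow> complex) \<Rightarrow> bool" where
  "contact_correspondence e c P e' c' P' \<longleftrightarrow>
     (\<forall>i. (\<forall>Q. touches c (side_line P i) Q \<longrightarrow>
             closed_segment (P' i) (P' (i + 1)) \<inter> principal_axis e' = {side_isometry P P' i Q}) \<and>
          (\<forall>T \<in> side_line P i.
             T \<in> principal_axis e \<longleftrightarrow> touches c' (side_line P' i) (side_isometry P P' i T)))"

end

theory Submission
  imports Defs
begin

text \<open>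
  A one-sheeted hyperboloid whose generators are rigid rods flexes through a confocal family
  and can be flattened in two ways, its generators becoming the tangents of the focal ellipse or of
  the focal hyperbola. The point with parameter \<open>t\<close> on the tangent of the unit circle at \<open>q\<close> is
  \<open>q (1 + \<i> t)\<close>. Scaling its coordinates by \<open>\<surd>(h\<^sup>2 + g\<^sup>2)\<close> and \<open>g\<close> gives a tangent of the ellipse with
  these semiaxes; replacing it by \<open>(h Re (q (1 + \<i> t)), \<plusminus> g t)\<close> gives a tangent of the hyperbola with
  semiaxes \<open>h\<close>, \<open>g\<close>, and both maps stretch lengths by the same factor. Sides of the billiard alternate
  between the two families of generators. Thus both kinds of billiards are given by the same sequence of unit
  vectors \<open>q\<^sub>i\<close> and tangent lengths \<open>s\<^sub>i\<close>, where \<open>q\<^sub>i\<^sub>-\<^sub>1 (1 + \<i> s\<^sub>i) = q\<^sub>i (1 - \<i> s\<^sub>i)\<close> is the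
  \<open>i\<close>-th vertex. The reflection law is equivalent to the constancy of Joachimsthal's integral, unless
  the billiard runs back along a side. A side length is a strictly monotonic function of the squared
  ordinate of \<open>q\<^sub>i\<close>, whence the uniqueness.
\<close>

subsection \<open>Coordinates in the frame of a conic\<close>

text \<open>The sign \<open>eps\<close> is forced by the joint. At a vertex the parameter jumps from
  \<open>s i\<close> to \<open>- s i\<close>, so the ordinate \<open>\<epsilon> * g * t\<close> of
  the hyperbolic position agrees on both sides only if \<open>\<epsilon>\<close> changes from side
  to side; the elliptic position contains no such sign. Two claims rest on this. After an odd period
  of the elliptic billiard the hyperbolic one has reached its mirror image in the principal axis, so
  its period doubles. And lines whose indices differ by an odd number lie in opposite families, for
  which both pictures impose the same equation on a common point; the lines through a grid point
  with even j are of this kind. The obstacle is that Joachimsthal's integral cannot tell a reflected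
  side from a side that is run back. With an elliptic caustic a side is never orthogonal to the
  ellipse, so running back is excluded. With a hyperbolic caustic it does occur, but only at common
  points of the ellipse and the caustic, and each passage between billiards and tangent sequences
  has to treat that case.\<close>

definition pt :: "conic \<Rightarrow> real \<Rightarrow> real \<Rightarrow> complex" where
  "pt C x y = centre C + x *\<^sub>R axis_dir C + y *\<^sub>R (\<i> * axis_dir C)"

lemma inner_frame:
  assumes "norm (u :: complex) = 1"
  shows "inner (x *\<^sub>R u + y *\<^sub>R (\<i> * u)) (x' *\<^sub>R u + y' *\<^sub>R (\<i> * u)) = x * x' + y * y'"
proof -
  have u: "(Re u)\<^sup>2 + (Im u)\<^sup>2 = 1"
    using assms by (metis cmod_power2 one_power2)
  have "inner (x *\<^sub>R u + y *\<^sub>R (\<i> * u)) (x' *\<^sub>R u + y' *\<^sub>R (\<i> * u)) =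
      (x * x' + y * y') * ((Re u)\<^sup>2 + (Im u)\<^sup>2)"
    by (simp add: inner_complex_def power2_eq_square algebra_simps)
  then show ?thesis
    using u by simp
qed

lemma xc_pt: "norm (axis_dir C) = 1 \<Longrightarrow> xc C (pt C x y) = x"
  using inner_frame[of "axis_dir C" x y 1 0] by (simp add: xc_def pt_def)

lemma yc_pt: "norm (axis_dir C) = 1 \<Longrightarrow> yc C (pt C x y) = y"
  using inner_frame[of "axis_dir C" x y 0 1] by (simp add: yc_def pt_def)

lemma pt_coords:
  assumes "norm (axis_dir C) = 1"
  shows "pt C (xc C X) (yc C X) = X"
proof -
  define u where "u = axis_dir C"
  have u: "Re u * Re u + Im u * Im u = 1"
    using assms unfolding u_def by (metis cmod_power2 one_power2 power2_eq_square)
  define d where "d = X - centre C"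
  have "inner d u *\<^sub>R u + inner d (\<i> * u) *\<^sub>R (\<i> * u) =
      Complex (Re d * (Re u * Re u + Im u * Im u)) (Im d * (Re u * Re u + Im u * Im u))"
    by (simp add: complex_eq_iff inner_complex_def algebra_simps)
  also have "\<dots> = d"
    unfolding u by simp
  finally show ?thesis
    by (simp add: pt_def xc_def yc_def d_def u_def add.assoc)
qed

lemma pt_diff:
  "pt C x y - pt C x' y' = (x - x') *\<^sub>R axis_dir C + (y - y') *\<^sub>R (\<i> * axis_dir C)"
  by (simp add: pt_def algebra_simps)

lemma pt_eq_iff: "norm (axis_dir C) = 1 \<Longrightarrow> pt C x y = pt C x' y' \<longleftrightarrow> x = x' \<and> y = y'"
  by (metis xc_pt yc_pt)

lemma dist_pt:
  assumes "norm (axis_dir C) = 1"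
  shows "(dist (pt C x y) (pt C x' y'))\<^sup>2 = (x - x')\<^sup>2 + (y - y')\<^sup>2"
  unfolding dist_norm pt_diff power2_norm_eq_inner inner_frame[OF assms]
  by (simp add: power2_eq_square)

lemma pt_in_points:
  "norm (axis_dir C) = 1 \<Longrightarrow> pt C x y \<in> points C \<longleftrightarrow> x\<^sup>2 / sqA C + y\<^sup>2 / sqB C = 1"
  by (simp add: points_def xc_pt yc_pt)

lemma pt_in_principal_axis:
  assumes "norm (axis_dir C) = 1" "sqB C < sqA C"
  shows "pt C x y \<in> principal_axis C \<longleftrightarrow> y = 0"
proof -
  define r where "r = sqrt (sqA C - sqB C)"
  have r: "r > 0"
    using assms by (simp add: r_def)
  have f: "centre C + r *\<^sub>R axis_dir C = pt C r 0" "centre C - r *\<^sub>R axis_dir C = pt C (- r) 0"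
    by (simp_all add: pt_def)
  have comb: "r1 *\<^sub>R pt C r 0 + r2 *\<^sub>R pt C (- r) 0 = pt C ((r1 - r2) * r) 0"
    if "r1 + r2 = 1" for r1 r2
  proof -
    have "r1 *\<^sub>R pt C r 0 + r2 *\<^sub>R pt C (- r) 0 =
        (r1 + r2) *\<^sub>R centre C + ((r1 - r2) * r) *\<^sub>R axis_dir C"
      by (simp add: pt_def algebra_simps)
    then show ?thesis
      using that by (simp add: pt_def)
  qed
  have "principal_axis C = {r1 *\<^sub>R pt C r 0 + r2 *\<^sub>R pt C (- r) 0 |r1 r2. r1 + r2 = 1}"
    by (simp add: principal_axis_def foci_def r_def[symmetric] f affine_hull_2)
  also have "\<dots> = {pt C ((r1 - r2) * r) 0 |r1 r2. r1 + r2 = 1}"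
    using comb by metis
  finally have *: "principal_axis C = {pt C ((r1 - r2) * r) 0 |r1 r2. r1 + r2 = 1}" .
  have "\<exists>r1 r2. x = (r1 - r2) * r \<and> r1 + r2 = 1"
    by (rule exI[of _ "(1 + x / r) / 2"], rule exI[of _ "(1 - x / r) / 2"])
      (use r in \<open>simp add: field_simps\<close>)
  then show ?thesis
    unfolding * by (auto simp: pt_eq_iff[OF assms(1)])
qed

text \<open>The centre is the midpoint of the foci and the axis direction comes from half their
  difference. The foci form an unordered pair, hence the free sign.\<close>

lemma confocal_iff:
  assumes "norm (axis_dir C) = 1" "sqB C < sqA C" "norm (axis_dir D) = 1" "sqB D < sqA D"
  shows "confocal C D \<longleftrightarrow> centre D = centre C \<and> sqA D - sqB D = sqA C - sqB C \<and>
    (axis_dir D = axis_dir C \<or> axis_dir D = - axis_dir C)"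
proof
  define r where "r = sqrt (sqA C - sqB C)"
  define r' where "r' = sqrt (sqA D - sqB D)"
  have r: "r > 0" "r' > 0"
    using assms by (simp_all add: r_def r'_def)
  assume "confocal C D"
  then have eq: "{centre C + r *\<^sub>R axis_dir C, centre C - r *\<^sub>R axis_dir C} =
      {centre D + r' *\<^sub>R axis_dir D, centre D - r' *\<^sub>R axis_dir D}"
    by (simp add: confocal_def foci_def r_def r'_def)
  then obtain \<sigma> :: real where \<sigma>: "\<sigma> = 1 \<or> \<sigma> = - 1"
    and 1: "centre C + r *\<^sub>R axis_dir C = centre D + (\<sigma> * r') *\<^sub>R axis_dir D"
    and 2: "centre C - r *\<^sub>R axis_dir C = centre D - (\<sigma> * r') *\<^sub>R axis_dir D"
  proof -
    from eq consider
      "centre C + r *\<^sub>R axis_dir C = centre D + r' *\<^sub>R axis_dir D \<and>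
       centre C - r *\<^sub>R axis_dir C = centre D - r' *\<^sub>R axis_dir D"
    | "centre C + r *\<^sub>R axis_dir C = centre D - r' *\<^sub>R axis_dir D \<and>
       centre C - r *\<^sub>R axis_dir C = centre D + r' *\<^sub>R axis_dir D"
      unfolding doubleton_eq_iff by blast
    then show ?thesis
    proof cases
      case 1
      then show ?thesis
        using that[of 1] by simp
    next
      case 2
      then show ?thesis
        using that[of "- 1"] by simp
    qed
  qed
  have "2 *\<^sub>R centre C = 2 *\<^sub>R centre D"
    using arg_cong2[OF 1 2, of "(+)"] by (simp add: scaleR_2)
  then have ctr: "centre C = centre D"
    by simp
  have ax: "r *\<^sub>R axis_dir C = (\<sigma> * r') *\<^sub>R axis_dir D"
    using 1 ctr by simp
  then have "norm (r *\<^sub>R axis_dir C) = norm ((\<sigma> * r') *\<^sub>R axis_dir D)"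
    by simp
  then have rr: "r = r'"
    using r \<sigma> assms by auto
  then have "axis_dir C = \<sigma> *\<^sub>R axis_dir D"
    using ax r by (metis mult.commute order_less_irrefl real_vector.scale_left_imp_eq scaleR_scaleR)
  moreover have "sqA D - sqB D = sqA C - sqB C"
    using rr by (simp add: r_def r'_def)
  ultimately show "centre D = centre C \<and> sqA D - sqB D = sqA C - sqB C \<and>
    (axis_dir D = axis_dir C \<or> axis_dir D = - axis_dir C)"
    using \<sigma> ctr by auto
next
  assume "centre D = centre C \<and> sqA D - sqB D = sqA C - sqB C \<and>
    (axis_dir D = axis_dir C \<or> axis_dir D = - axis_dir C)"
  then show "confocal C D"
    by (auto simp: confocal_def foci_def)
qed

text \<open>Equality of foci fixes the axis direction only up to sign, which the equations do not see.\<close>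

definition aligned :: "conic \<Rightarrow> conic \<Rightarrow> bool" where
  "aligned e c \<longleftrightarrow> norm (axis_dir e) = 1 \<and> centre c = centre e \<and>
     (axis_dir c = axis_dir e \<or> axis_dir c = - axis_dir e)"

text \<open>A flipped axis vector negates both coordinates at once; the equations of conics and
  tangents contain only products in which this sign cancels.\<close>

lemma aligned_coords:
  assumes "aligned e c"
  shows "xc c X * xc c Y = xc e X * xc e Y" "yc c X * yc c Y = yc e X * yc e Y"
  using assms by (auto simp: aligned_def xc_def yc_def)

lemma aligned_points:
  "aligned e c \<Longrightarrow> pt e x y \<in> points c \<longleftrightarrow> x\<^sup>2 / sqA c + y\<^sup>2 / sqB c = 1"
  using aligned_coords[of e c "pt e x y" "pt e x y"]
  by (auto simp: points_def power2_eq_square xc_pt yc_pt aligned_def)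

lemma aligned_tangent_at:
  "aligned e c \<Longrightarrow> pt e x y \<in> tangent_at c (pt e x' y') \<longleftrightarrow> x' * x / sqA c + y' * y / sqB c = 1"
  using aligned_coords[of e c "pt e x' y'" "pt e x y"]
  by (auto simp: tangent_at_def xc_pt yc_pt aligned_def)

lemma aligned_asymptotes:
  assumes "aligned e c" "is_hyperbola c"
  shows "L \<in> asymptotes c \<longleftrightarrow> (\<exists>s \<in> {1, - 1}. L =
    {X. xc e X / sqrt (sqA c) = s * (yc e X / sqrt (- sqB c))})"
proof -
  have e: "(\<exists>s \<in> {1, - 1 :: real}. Q s) \<longleftrightarrow> Q 1 \<or> Q (- 1)"
    "(\<exists>s. Q s \<and> s \<in> {1, - 1 :: real}) \<longleftrightarrow> Q 1 \<or> Q (- 1)" for Q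
    by blast+
  have "axis_dir c = axis_dir e \<or> axis_dir c = - axis_dir e" "centre c = centre e"
    using assms by (auto simp: aligned_def)
  then have "(\<forall>X. xc c X = xc e X \<and> yc c X = yc e X) \<or> (\<forall>X. xc c X = - xc e X \<and> yc c X = - yc e X)"
    by (auto simp: xc_def yc_def)
  moreover have "L \<in> asymptotes c \<longleftrightarrow> (\<exists>s. L =
    {X. xc c X / sqrt (sqA c) = s * (yc c X / sqrt (- sqB c))} \<and> s \<in> {1, - 1})"
    using assms(2) unfolding asymptotes_def by auto
  ultimately show ?thesis
    unfolding e by auto
qed

text \<open>Only two unit vectors have the prescribed component along \<open>n\<close>, namely the
  mirror image of \<open>v\<close> and \<open>- v\<close>. They coincide exactly when
  \<open>v\<close> is parallel to \<open>n\<close>, which is the equality case of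
  Cauchy-Schwarz.\<close>

lemma mirrorI:
  fixes v w n :: complex
  assumes "norm v = 1" "norm w = 1" "n \<noteq> 0" "inner w n = - inner v n"
    and "w \<noteq> - v \<or> (inner v n)\<^sup>2 = inner n n"
  shows "w = mirror n v"
proof -
  define \<nu> where "\<nu> = inner n n"
  have \<nu>: "\<nu> > 0"
    using assms by (simp add: \<nu>_def)
  \<comment> \<open>\<open>cr z\<close> is the component along the tangent vector
    \<open>- \<i> * n\<close>, and \<open>lag\<close> is Pythagoras for the two components.\<close>
  define cr where "cr = (\<lambda>z. Re z * Im n - Im z * Re n)"
  have lag: "(inner z n)\<^sup>2 + (cr z)\<^sup>2 = \<nu> * (norm z)\<^sup>2" for z
    unfolding cmod_power2
    by (simp add: cr_def \<nu>_def inner_complex_def power2_eq_square algebra_simps)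
  have dec: "\<nu> *\<^sub>R z = inner z n *\<^sub>R n + cr z *\<^sub>R (- \<i> * n)" for z
    by (simp add: cr_def \<nu>_def inner_complex_def complex_eq_iff algebra_simps)
  have cr: "cr w = cr v"
  proof (rule ccontr)
    assume ne: "cr w \<noteq> cr v"
    have "(cr w)\<^sup>2 = (cr v)\<^sup>2"
      using lag[of w] lag[of v] assms by simp
    then have cr: "cr w = - cr v"
      using ne by (simp add: power2_eq_iff)
    then have "\<nu> *\<^sub>R w = \<nu> *\<^sub>R (- v)"
      using dec[of w] dec[of v] assms(4) by simp
    then have "w = - v"
      using \<nu> by (metis less_irrefl real_vector.scale_left_imp_eq)
    then have "(inner v n)\<^sup>2 = \<nu>"
      using assms by (simp add: \<nu>_def)
    then have "cr v = 0"
      using lag[of v] assms by simp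
    then show False
      using ne cr by simp
  qed
  have "\<nu> *\<^sub>R w = \<nu> *\<^sub>R v - (2 * inner v n) *\<^sub>R n"
    unfolding dec[of w] dec[of v] cr assms(4) by (simp only: mult_2 scaleR_add_left scaleR_minus_left) simp
  moreover have "\<nu> *\<^sub>R mirror n v = \<nu> *\<^sub>R v - (2 * inner v n) *\<^sub>R n"
    using \<nu> by (simp add: mirror_def \<nu>_def[symmetric] scaleR_diff_right)
  ultimately have "\<nu> *\<^sub>R w = \<nu> *\<^sub>R mirror n v"
    by simp
  then show ?thesis
    using \<nu> by (metis less_irrefl real_vector.scale_left_imp_eq)
qed

text \<open>A mirror reverses only vectors parallel to its normal.\<close>

lemma mirror_back:
  fixes v n :: complex
  assumes "norm v = 1" "n \<noteq> 0" "- v = mirror n v"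
  shows "(inner v n)\<^sup>2 = inner n n"
proof -
  have "2 *\<^sub>R v = (2 * inner v n / inner n n) *\<^sub>R n"
    using assms(3) by (simp add: mirror_def scaleR_2 algebra_simps)
  then have "inner v (2 *\<^sub>R v) = inner v ((2 * inner v n / inner n n) *\<^sub>R n)"
    by simp
  then have "2 = 2 * (inner v n)\<^sup>2 / inner n n"
    using assms(1) by (simp add: power2_eq_square dot_square_norm)
  then show ?thesis
    using assms(2) by (simp add: field_simps)
qed

subsection \<open>The reflection law and Joachimsthal's integral\<close>

lemma affine_hull_param:
  fixes M D :: "'a :: real_vector"
  assumes "a \<noteq> b"
  shows "affine hull {M + a *\<^sub>R D, M + b *\<^sub>R D} = range (\<lambda>t. M + t *\<^sub>R D)"
proof (intro equalityI subsetI)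
  fix X
  assume "X \<in> affine hull {M + a *\<^sub>R D, M + b *\<^sub>R D}"
  then obtain u v where uv: "u + v = 1" and X: "X = u *\<^sub>R (M + a *\<^sub>R D) + v *\<^sub>R (M + b *\<^sub>R D)"
    unfolding affine_hull_2 by blast
  have "X = (u + v) *\<^sub>R M + (u * a + v * b) *\<^sub>R D"
    unfolding X by (simp add: algebra_simps)
  then have "X = M + (u * a + v * b) *\<^sub>R D"
    unfolding uv by simp
  then show "X \<in> range (\<lambda>t. M + t *\<^sub>R D)"
    by (rule range_eqI)
next
  fix X
  assume "X \<in> range (\<lambda>t. M + t *\<^sub>R D)"
  then obtain t where X: "X = M + t *\<^sub>R D"
    by blast
  define v where "v = (t - a) / (b - a)"
  have t: "(1 - v) * a + v * b = t"
  proof -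
    have "v * (b - a) = t - a"
      using assms by (simp add: v_def)
    then show ?thesis
      by (simp add: algebra_simps)
  qed
  have "(1 - v) *\<^sub>R (M + a *\<^sub>R D) + v *\<^sub>R (M + b *\<^sub>R D) = M + ((1 - v) * a + v * b) *\<^sub>R D"
    by (simp add: algebra_simps)
  also have "\<dots> = X"
    unfolding X t ..
  finally show "X \<in> affine hull {M + a *\<^sub>R D, M + b *\<^sub>R D}"
    unfolding affine_hull_2 by (smt (verit, best) mem_Collect_eq)
qed

text \<open>Two parametrised lines on which corresponding vertices have equal parameters are matched
  parameter by parameter. Incidences can therefore be compared through one number
  \<open>t\<close>.\<close>

lemma side_isometry_param:
  assumes "P i = M + a *\<^sub>R D" "P (i + 1) = M + b *\<^sub>R D" "a \<noteq> b" "D \<noteq> 0"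
    and "P' i = M' + a *\<^sub>R D'" "P' (i + 1) = M' + b *\<^sub>R D'"
  shows "side_isometry P P' i (M + t *\<^sub>R D) = M' + t *\<^sub>R D'"
proof -
  have 1: "M + t *\<^sub>R D - P i = (t - a) *\<^sub>R D" "P (i + 1) - P i = (b - a) *\<^sub>R D"
    "P' (i + 1) - P' i = (b - a) *\<^sub>R D'"
    using assms by (simp_all add: algebra_simps)
  have "(dist (P i) (P (i + 1)))\<^sup>2 = (b - a)\<^sup>2 * inner D D"
    using 1(2) by (metis dist_commute dist_norm norm_scaleR power2_abs power2_norm_eq_inner
        power_mult_distrib)
  then have "side_isometry P P' i (M + t *\<^sub>R D) =
      P' i + (((t - a) * (b - a) * inner D D) / ((b - a)\<^sup>2 * inner D D)) *\<^sub>R ((b - a) *\<^sub>R D')"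
    unfolding side_isometry_def 1 by (simp add: mult_ac)
  also have "\<dots> = P' i + (t - a) *\<^sub>R D'"
    using assms(3,4) by (simp add: power2_eq_square)
  also have "\<dots> = M' + t *\<^sub>R D'"
    using assms by (simp add: algebra_simps)
  finally show ?thesis .
qed

text \<open>The quadratic form of \<open>e\<close>, without its constant term, applied to
  \<open>Y - X\<close>.\<close>

definition quad :: "conic \<Rightarrow> complex \<Rightarrow> complex \<Rightarrow> real" where
  "quad e X Y = (xc e Y - xc e X)\<^sup>2 / sqA e + (yc e Y - yc e X)\<^sup>2 / sqB e"

lemma inner_normal_vec:
  assumes "norm (axis_dir e) = 1"
  shows "inner (Y - X) (normal_vec e Z) =
    (xc e Y - xc e X) * xc e Z / sqA e + (yc e Y - yc e X) * yc e Z / sqB e"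
proof -
  have "Y - X = (xc e Y - xc e X) *\<^sub>R axis_dir e + (yc e Y - yc e X) *\<^sub>R (\<i> * axis_dir e)"
    using pt_coords[OF assms] pt_diff by metis
  then show ?thesis
    unfolding normal_vec_def by (simp add: inner_frame[OF assms])
qed

lemma normal_vec_square:
  assumes "norm (axis_dir e) = 1"
  shows "inner (normal_vec e Z) (normal_vec e Z) = (xc e Z / sqA e)\<^sup>2 + (yc e Z / sqB e)\<^sup>2"
  unfolding normal_vec_def inner_frame[OF assms] by (simp add: power2_eq_square)

text \<open>Both ends satisfy the equation of \<open>e\<close>, so each product equals, up to sign,
  1 minus the polar form of the two ends. The symmetry of that form is why the integral is the same
  at both ends of a side.\<close>

lemma chord_normal:
  assumes "norm (axis_dir e) = 1" "X \<in> points e" "Y \<in> points e"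
  shows "inner (Y - X) (normal_vec e X) = - quad e X Y / 2"
    "inner (Y - X) (normal_vec e Y) = quad e X Y / 2"
  using assms(2,3) unfolding inner_normal_vec[OF assms(1)] quad_def points_def
  by (simp_all add: power2_eq_square algebra_simps diff_divide_distrib add_divide_distrib)

lemma quad_pos:
  assumes "is_ellipse e" "X \<noteq> Y"
  shows "quad e X Y > 0"
proof -
  have "xc e Y - xc e X \<noteq> 0 \<or> yc e Y - yc e X \<noteq> 0"
    using assms pt_coords[of e] unfolding is_ellipse_def
    by (metis eq_iff_diff_eq_0)
  then show ?thesis
    using assms unfolding quad_def is_ellipse_def
    by (smt (verit) divide_nonneg_pos divide_pos_pos zero_le_power2 zero_less_power2)
qed

lemma normal_vec_nonzero:
  assumes "is_ellipse e" "X \<in> points e"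
  shows "normal_vec e X \<noteq> 0"
proof
  assume "normal_vec e X = 0"
  moreover have "inner (X - centre e) (normal_vec e X) = 1"
    using inner_normal_vec[of e X "centre e" X] assms
    by (simp add: is_ellipse_def points_def power2_eq_square xc_def yc_def)
  ultimately show False
    by simp
qed

lemma inner_sgn: "inner (sgn v) n = inner v n / norm v"
  by (simp add: sgn_div_norm divide_inverse mult.commute)

text \<open>
  \<open>J\<close> is the square of Joachimsthal's integral \<open>inner v n\<close>; where a side is orthogonal to the
  ellipse, the billiard runs back along it.
\<close>

lemma billiardI:
  assumes e: "is_ellipse e" and on: "\<And>i. P i \<in> points e" and ne: "\<And>i. P i \<noteq> P (i + 1)"
    and J: "\<And>i. (quad e (P i) (P (i + 1)))\<^sup>2 = 4 * J * (dist (P i) (P (i + 1)))\<^sup>2"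
    and turn: "\<And>i. sgn (P (i + 1) - P i) = - sgn (P i - P (i - 1)) \<Longrightarrow>
      inner (normal_vec e (P i)) (normal_vec e (P i)) = J"
  shows "billiard e P"
proof -
  have u: "norm (axis_dir e) = 1"
    using e by (simp add: is_ellipse_def)
  \<comment> \<open>Positivity of \<open>quad\<close> restores the sign lost in squaring: incoming
    sides get \<open>sqrt J\<close>, outgoing ones \<open>- sqrt J\<close>.\<close>
  have J': "quad e (P i) (P (i + 1)) / (2 * norm (P (i + 1) - P i)) = sqrt J" for i
  proof -
    define Q where "Q = quad e (P i) (P (i + 1))"
    define d where "d = norm (P (i + 1) - P i)"
    have "Q > 0" "d > 0" "Q\<^sup>2 = 4 * J * d\<^sup>2"
      using quad_pos[OF e ne] ne[of i] J[of i]
      by (simp_all add: Q_def d_def dist_norm norm_minus_commute)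
    then have "(Q / (2 * d))\<^sup>2 = J" "Q / (2 * d) > 0"
      by (simp_all add: power_divide power_mult_distrib)
    then show ?thesis
      unfolding Q_def d_def by (metis real_sqrt_unique less_imp_le)
  qed
  have "sgn (P (i + 1) - P i) = mirror (normal_vec e (P i)) (sgn (P i - P (i - 1)))" for i
  proof (rule mirrorI)
    have nz: "P (i + 1) - P i \<noteq> 0" "P i - P (i - 1) \<noteq> 0"
      using ne[of i] ne[of "i - 1"] by auto
    show "norm (sgn (P i - P (i - 1))) = 1" "norm (sgn (P (i + 1) - P i)) = 1"
      using nz by (simp_all add: norm_sgn)
    show "normal_vec e (P i) \<noteq> 0"
      using normal_vec_nonzero[OF e on] .
    have 1: "inner (sgn (P (i + 1) - P i)) (normal_vec e (P i)) = - sqrt J"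
      unfolding inner_sgn chord_normal(1)[OF u on on] J'[of i, symmetric] by simp
    have 2: "inner (sgn (P i - P (i - 1))) (normal_vec e (P i)) = sqrt J"
      using J'[of "i - 1"] unfolding inner_sgn chord_normal(2)[OF u on on] by simp
    show "inner (sgn (P (i + 1) - P i)) (normal_vec e (P i)) =
        - inner (sgn (P i - P (i - 1))) (normal_vec e (P i))"
      using 1 2 by simp
    have "J \<ge> 0"
      using J[of i] ne[of i] by (smt (verit, best) zero_le_mult_iff zero_le_power2 zero_less_dist_iff zero_less_power)
    then show "sgn (P (i + 1) - P i) \<noteq> - sgn (P i - P (i - 1)) \<or>
        (inner (sgn (P i - P (i - 1))) (normal_vec e (P i)))\<^sup>2 =
        inner (normal_vec e (P i)) (normal_vec e (P i))"
      using turn[of i] 2 by auto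
  qed
  then show ?thesis
    using assms by (auto simp: billiard_def)
qed

text \<open>Counterpart of the assumption \<open>turn\<close> above: a true reversal meets the
  ellipse orthogonally, so the integral equals the length of the normal. It serves to exclude or
  locate reversals in a given billiard.\<close>

lemma billiard_back:
  assumes "billiard e P" "P (i + 1) = P (i - 1)"
    and J: "(quad e (P (i - 1)) (P i))\<^sup>2 = 4 * J * (dist (P (i - 1)) (P i))\<^sup>2"
  shows "inner (normal_vec e (P i)) (normal_vec e (P i)) = J"
proof -
  have e: "is_ellipse e" and on: "\<And>i. P i \<in> points e" and ne: "\<And>i. P i \<noteq> P (i + 1)"
    and m: "sgn (P (i + 1) - P i) = mirror (normal_vec e (P i)) (sgn (P i - P (i - 1)))"
    using assms(1) by (auto simp: billiard_def)
  have u: "norm (axis_dir e) = 1"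
    using e by (simp add: is_ellipse_def)
  have nz: "P i - P (i - 1) \<noteq> 0"
    using ne[of "i - 1"] by auto
  have "- sgn (P i - P (i - 1)) = mirror (normal_vec e (P i)) (sgn (P i - P (i - 1)))"
    using m assms(2) by (metis minus_diff_eq sgn_minus)
  then have "(inner (sgn (P i - P (i - 1))) (normal_vec e (P i)))\<^sup>2 =
      inner (normal_vec e (P i)) (normal_vec e (P i))"
    using mirror_back normal_vec_nonzero[OF e on] nz by (metis norm_sgn)
  moreover have "inner (sgn (P i - P (i - 1))) (normal_vec e (P i)) =
      quad e (P (i - 1)) (P i) / (2 * norm (P i - P (i - 1)))"
    using chord_normal(2)[OF u on on, of i "i - 1"] nz
    by (simp add: inner_sgn field_simps)
  moreover have "(quad e (P (i - 1)) (P i) / (2 * norm (P i - P (i - 1))))\<^sup>2 = J"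
    using J nz by (simp add: power_divide power_mult_distrib dist_norm norm_minus_commute)
  ultimately show ?thesis
    by simp
qed

section \<open>The vertices on a side line as roots of a quadratic equation\<close>

lemma sum_squares_pos:
  fixes h g k :: real
  assumes "0 < k"
  shows "0 < h\<^sup>2 + g\<^sup>2 + k" "0 < g\<^sup>2 + k"
  using assms by (simp_all add: add_nonneg_pos)

text \<open>
  Restricting the equation of the ellipse \<open>e\<close> to a side line leads to this same condition on the
  parameter for both kinds of caustic.
\<close>

definition vertex_param :: "real \<Rightarrow> real \<Rightarrow> real \<Rightarrow> complex \<Rightarrow> real \<Rightarrow> bool" where
  "vertex_param h g k q t \<longleftrightarrow>
     h\<^sup>2 * (Re (q * Complex 1 t))\<^sup>2 / (h\<^sup>2 + g\<^sup>2 + k) + g\<^sup>2 * t\<^sup>2 / k = 1"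

lemma norm_1_cmod: "norm (q :: complex) = 1 \<longleftrightarrow> (Re q)\<^sup>2 + (Im q)\<^sup>2 = 1"
  by (metis cmod_power2 norm_ge_zero one_power2 power2_eq_imp_eq zero_le_one)

text \<open>Pythagoras for a tangent of the unit circle. Two tangents through one point thus have
  parameters of equal absolute value, the fact behind all later comparisons at vertices and grid
  points.\<close>

lemma unit_tangent_square:
  assumes "norm q = 1"
  shows "(Re (q * Complex 1 t))\<^sup>2 + (Im (q * Complex 1 t))\<^sup>2 = 1 + t\<^sup>2"
proof -
  have "(Re (q * Complex 1 t))\<^sup>2 + (Im (q * Complex 1 t))\<^sup>2 = ((Re q)\<^sup>2 + (Im q)\<^sup>2) * (1 + t\<^sup>2)"
    by (simp add: power2_eq_square algebra_simps)
  then show ?thesis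
    using assms norm_1_cmod by simp
qed

text \<open>Replacing \<open>t^2\<close> by \<open>x + y - 1\<close> and clearing denominators makes
  the two equations identical, because \<open>h^2 * k + g^2 * (h^2 + g^2 + k)\<close> factors as
  \<open>(h^2 + g^2) * (g^2 + k)\<close>.\<close>

lemma vertex_param_ellipse:
  assumes "0 < h" "0 < g" "0 < k" "norm q = 1"
  shows "vertex_param h g k q t \<longleftrightarrow>
    (h\<^sup>2 + g\<^sup>2) * (Re (q * Complex 1 t))\<^sup>2 / (h\<^sup>2 + g\<^sup>2 + k) + g\<^sup>2 * (Im (q * Complex 1 t))\<^sup>2 / (g\<^sup>2 + k) = 1"
proof -
  define x y where "x = (Re (q * Complex 1 t))\<^sup>2" and "y = (Im (q * Complex 1 t))\<^sup>2"
  have t: "t\<^sup>2 = x + y - 1"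
    using unit_tangent_square[OF assms(4), of t] by (simp add: x_def y_def)
  have p: "h\<^sup>2 + g\<^sup>2 + k > 0" "g\<^sup>2 + k > 0"
    using sum_squares_pos assms(3) by auto
  have "vertex_param h g k q t \<longleftrightarrow>
      h\<^sup>2 * x * k + g\<^sup>2 * (x + y - 1) * (h\<^sup>2 + g\<^sup>2 + k) = (h\<^sup>2 + g\<^sup>2 + k) * k"
    unfolding vertex_param_def x_def[symmetric] t using p assms(3) by (simp add: divide_simps)
  also have "\<dots> \<longleftrightarrow> (h\<^sup>2 + g\<^sup>2) * x * (g\<^sup>2 + k) + g\<^sup>2 * y * (h\<^sup>2 + g\<^sup>2 + k) = (h\<^sup>2 + g\<^sup>2 + k) * (g\<^sup>2 + k)"
    by (simp add: algebra_simps)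
  also have "\<dots> \<longleftrightarrow> (h\<^sup>2 + g\<^sup>2) * x / (h\<^sup>2 + g\<^sup>2 + k) + g\<^sup>2 * y / (g\<^sup>2 + k) = 1"
    using p by (simp add: divide_simps)
  finally show ?thesis
    by (simp add: x_def y_def)
qed

text \<open>The leading coefficient of the vertex equation, seen as a quadratic in
  \<open>t\<close>.\<close>

definition line_quad :: "real \<Rightarrow> real \<Rightarrow> real \<Rightarrow> complex \<Rightarrow> real" where
  "line_quad h g k q = h\<^sup>2 * (Im q)\<^sup>2 / (h\<^sup>2 + g\<^sup>2 + k) + g\<^sup>2 / k"

text \<open>The squared length of the direction vector in both flattened positions; that it is
  common to them makes the polygons isometric.\<close>

definition dir_square :: "real \<Rightarrow> real \<Rightarrow> complex \<Rightarrow> real" where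
  "dir_square h g q = h\<^sup>2 * (Im q)\<^sup>2 + g\<^sup>2"

lemma vertex_param_quadratic:
  "vertex_param h g k q t \<longleftrightarrow>
     line_quad h g k q * t\<^sup>2 - 2 * (h\<^sup>2 * Re q * Im q / (h\<^sup>2 + g\<^sup>2 + k)) * t
     + (h\<^sup>2 * (Re q)\<^sup>2 / (h\<^sup>2 + g\<^sup>2 + k) - 1) = 0"
proof -
  have "h\<^sup>2 * (Re (q * Complex 1 t))\<^sup>2 / (h\<^sup>2 + g\<^sup>2 + k) + g\<^sup>2 * t\<^sup>2 / k - 1 =
      line_quad h g k q * t\<^sup>2 - 2 * (h\<^sup>2 * Re q * Im q / (h\<^sup>2 + g\<^sup>2 + k)) * t
     + (h\<^sup>2 * (Re q)\<^sup>2 / (h\<^sup>2 + g\<^sup>2 + k) - 1)"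
    unfolding line_quad_def
    by (simp add: power2_eq_square algebra_simps add_divide_distrib diff_divide_distrib)
  then show ?thesis
    unfolding vertex_param_def by linarith
qed

lemma line_quad_pos: "0 < g \<Longrightarrow> 0 < k \<Longrightarrow> line_quad h g k q > 0"
  unfolding line_quad_def by (simp add: add_nonneg_pos)

lemma quadratic_roots:
  fixes a b c x y :: real
  assumes "a * x\<^sup>2 - 2 * b * x + c = 0" "a * y\<^sup>2 - 2 * b * y + c = 0" "x \<noteq> y"
  shows "a * (x + y) = 2 * b" "a * (x * y) = c" "(x - y)\<^sup>2 * a\<^sup>2 = 4 * (b\<^sup>2 - a * c)"
proof -
  have "(x - y) * (a * (x + y) - 2 * b) = 0"
    using assms(1,2) by (simp add: power2_eq_square algebra_simps)
  then show 1: "a * (x + y) = 2 * b"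
    using assms(3) by simp
  have "a * (x * y) = x * (a * (x + y)) - a * x\<^sup>2"
    by (simp add: power2_eq_square algebra_simps)
  then show 2: "a * (x * y) = c"
    using assms(1) unfolding 1 by (simp add: algebra_simps)
  have "(x - y)\<^sup>2 * a\<^sup>2 = (a * (x + y))\<^sup>2 - 4 * a * (a * (x * y))"
    by (simp add: power2_eq_square algebra_simps)
  then show "(x - y)\<^sup>2 * a\<^sup>2 = 4 * (b\<^sup>2 - a * c)"
    unfolding 1 2 by (simp add: power2_eq_square)
qed

text \<open>The constant term of the quadratic is negative, so \<open>t = 0\<close> lies strictly
  between the vertices. The discriminant splits into a factor that depends on the conics only and
  \<open>dir_square\<close>; this splitting is the constancy of Joachimsthal's integral over all
  tangents.\<close>

lemma vertex_params:
  assumes "0 < h" "0 < g" "0 < k" "norm q = 1"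
    and "vertex_param h g k q x" "vertex_param h g k q y" "x \<noteq> y"
  shows "x * y < 0"
    "(x - y)\<^sup>2 * (line_quad h g k q)\<^sup>2 =
       4 * ((g\<^sup>2 + k) / ((h\<^sup>2 + g\<^sup>2 + k) * k)) * dir_square h g q"
proof -
  define a2 where "a2 = h\<^sup>2 + g\<^sup>2 + k"
  have a2: "a2 > 0"
    using sum_squares_pos assms(3) by (auto simp: a2_def)
  have C: "(Re q)\<^sup>2 = 1 - (Im q)\<^sup>2"
    using assms(4) norm_1_cmod by (simp add: eq_diff_eq)
  have lq: "line_quad h g k q > 0"
    using assms line_quad_pos by blast
  note r = quadratic_roots[OF assms(5,6)[unfolded vertex_param_quadratic] assms(7)]
  have "h\<^sup>2 * (Re q)\<^sup>2 \<le> h\<^sup>2"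
    using C by (simp add: mult_left_le)
  also have "h\<^sup>2 < a2"
    using assms by (simp add: a2_def add_pos_pos)
  finally have "h\<^sup>2 * (Re q)\<^sup>2 / a2 - 1 < 0"
    using a2 by simp
  then show "x * y < 0"
    using r(2) lq a2_def by (metis mult_less_0_iff not_less_iff_gr_or_eq)
  have "(h\<^sup>2 * Re q * Im q / a2)\<^sup>2 - line_quad h g k q * (h\<^sup>2 * (Re q)\<^sup>2 / a2 - 1) =
    (h\<^sup>2 * (Im q)\<^sup>2 * k + g\<^sup>2 * (a2 - h\<^sup>2 * (Re q)\<^sup>2)) / (a2 * k)"
    unfolding line_quad_def a2_def[symmetric] using a2 assms(3)
    by (simp add: field_simps power2_eq_square)
  also have "\<dots> = (g\<^sup>2 + k) / (a2 * k) * dir_square h g q"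
    unfolding C dir_square_def by (simp add: a2_def algebra_simps)
  finally show "(x - y)\<^sup>2 * (line_quad h g k q)\<^sup>2 =
       4 * ((g\<^sup>2 + k) / ((h\<^sup>2 + g\<^sup>2 + k) * k)) * dir_square h g q"
    using r(3) by (simp add: a2_def)
qed

text \<open>One root determines the other through the sum of the roots.\<close>

lemma vertex_param_third:
  assumes "0 < g" "0 < k"
    and "vertex_param h g k q x" "vertex_param h g k q y" "vertex_param h g k q z" "x \<noteq> y" "x \<noteq> z"
  shows "y = z"
proof -
  have "line_quad h g k q * (x + y) = line_quad h g k q * (x + z)"
    using quadratic_roots(1)[OF assms(3,4)[unfolded vertex_param_quadratic] assms(6)]
      quadratic_roots(1)[OF assms(3,5)[unfolded vertex_param_quadratic] assms(7)] by simp
  then show ?thesis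
    using line_quad_pos[OF assms(1,2), of h q] by simp
qed

subsection \<open>Tangents of confocal ellipses and hyperbolas\<close>

text \<open>Side \<open>i\<close> runs from the parameter \<open>- s i\<close> to
  \<open>s (i + 1)\<close>. The sign condition puts these on different sides of 0, so the next
  vertex is the other root of the vertex equation and not the old one. The condition at the end of
  the side is inherited from the next index through the joint.\<close>

definition chain :: "real \<Rightarrow> real \<Rightarrow> real \<Rightarrow> (int \<Rightarrow> complex) \<Rightarrow> (int \<Rightarrow> real) \<Rightarrow> bool" where
  "chain h g k q s \<longleftrightarrow> (\<forall>i. norm (q i) = 1 \<and> 0 < s i * s (i + 1) \<and>
     q (i - 1) * Complex 1 (s i) = q i * Complex 1 (- s i) \<and> vertex_param h g k (q i) (- s i))"

lemma chainD:
  assumes "chain h g k q s"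
  shows "norm (q i) = 1" "0 < s i * s (i + 1)"
    "q i * Complex 1 (s (i + 1)) = q (i + 1) * Complex 1 (- s (i + 1))"
    "vertex_param h g k (q i) (- s i)" "vertex_param h g k (q i) (s (i + 1))"
    "s i \<noteq> 0" "- s i \<noteq> s (i + 1)" "q i \<noteq> 0"
proof -
  have c: "norm (q i) = 1" "0 < s i * s (i + 1)"
    "q (i - 1) * Complex 1 (s i) = q i * Complex 1 (- s i)" "vertex_param h g k (q i) (- s i)" for i
    using assms unfolding chain_def by blast+
  show "norm (q i) = 1" "0 < s i * s (i + 1)" "vertex_param h g k (q i) (- s i)"
    using c by blast+
  show n: "q i * Complex 1 (s (i + 1)) = q (i + 1) * Complex 1 (- s (i + 1))"
    using c(3)[of "i + 1"] by simp
  show "vertex_param h g k (q i) (s (i + 1))"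
    using c(4)[of "i + 1"] unfolding vertex_param_def n by simp
  show "s i \<noteq> 0"
    using c(2)[of i] by auto
  show "- s i \<noteq> s (i + 1)"
    using c(2)[of i] by (metis mult_minus_left mult_minus_right neg_0_less_iff_less not_square_less_zero)
  show "q i \<noteq> 0"
    using c(1)[of i] by auto
qed

text \<open>Here \<open>h\<close> is the linear eccentricity, \<open>g\<close> the minor semiaxis of
  the caustic, and \<open>k\<close> the amount by which the squared semiaxes of \<open>e\<close>
  exceed those of \<open>c\<close>. In the hyperbolic companion \<open>k\<close> is the squared
  minor semiaxis of the ellipse, while its major semiaxis is the same as here.\<close>

definition ell_family :: "real \<Rightarrow> real \<Rightarrow> real \<Rightarrow> conic \<Rightarrow> conic \<Rightarrow> bool" where
  "ell_family h g k e c \<longleftrightarrow> 0 < h \<and> 0 < g \<and> 0 < k \<and> aligned e c \<and>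
     sqA e = h\<^sup>2 + g\<^sup>2 + k \<and> sqB e = g\<^sup>2 + k \<and> sqA c = h\<^sup>2 + g\<^sup>2 \<and> sqB c = g\<^sup>2"

definition hyp_family :: "real \<Rightarrow> real \<Rightarrow> real \<Rightarrow> conic \<Rightarrow> conic \<Rightarrow> bool" where
  "hyp_family h g k e c \<longleftrightarrow> 0 < h \<and> 0 < g \<and> 0 < k \<and> aligned e c \<and>
     sqA e = h\<^sup>2 + g\<^sup>2 + k \<and> sqB e = k \<and> sqA c = h\<^sup>2 \<and> sqB c = - g\<^sup>2"

lemma ell_familyD:
  assumes "ell_family h g k e c"
  shows "0 < h" "0 < g" "0 < k" "norm (axis_dir e) = 1" "aligned e c" "is_ellipse e" "is_ellipse c"
    "confocal e c" "sqB e < sqA e" "\<not> is_hyperbola c"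
proof -
  show *: "0 < h" "0 < g" "0 < k" "norm (axis_dir e) = 1" "aligned e c"
    using assms by (auto simp: ell_family_def aligned_def)
  moreover have "norm (axis_dir c) = 1"
    using \<open>aligned e c\<close> by (auto simp: aligned_def)
  ultimately show **: "is_ellipse e" "is_ellipse c" "sqB e < sqA e" "\<not> is_hyperbola c"
    using assms sum_squares_pos by (auto simp: ell_family_def is_ellipse_def is_hyperbola_def)
  have "norm (axis_dir e) = 1" "sqB e < sqA e" "norm (axis_dir c) = 1" "sqB c < sqA c"
    using ** by (auto simp: is_ellipse_def)
  then show "confocal e c"
    using assms by (subst confocal_iff) (auto simp: ell_family_def aligned_def)
qed

lemma hyp_familyD:
  assumes "hyp_family h g k e c"
  shows "0 < h" "0 < g" "0 < k" "norm (axis_dir e) = 1" "aligned e c" "is_ellipse e" "is_hyperbola c"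
    "confocal e c" "sqB e < sqA e"
proof -
  show *: "0 < h" "0 < g" "0 < k" "norm (axis_dir e) = 1" "aligned e c"
    using assms by (auto simp: hyp_family_def aligned_def)
  moreover have "norm (axis_dir c) = 1"
    using \<open>aligned e c\<close> by (auto simp: aligned_def)
  moreover have "h\<^sup>2 + g\<^sup>2 > 0"
    using * by (simp add: add_pos_pos)
  ultimately show **: "is_ellipse e" "is_hyperbola c" "sqB e < sqA e"
    using assms by (auto simp: hyp_family_def is_ellipse_def is_hyperbola_def)
  have "norm (axis_dir e) = 1" "sqB e < sqA e" "norm (axis_dir c) = 1" "sqB c < sqA c"
    using ** by (auto simp: is_ellipse_def is_hyperbola_def)
  then show "confocal e c"
    using assms by (subst confocal_iff) (auto simp: hyp_family_def aligned_def)
qed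

text \<open>
  \<open>ell_line\<close> and \<open>hyp_line\<close> with the same \<open>q\<close> are two flattened positions of one generator of a
  flexible one-sheeted hyperboloid; the sign \<open>\<epsilon>\<close> selects the family of generators.
\<close>

definition ell_line :: "conic \<Rightarrow> real \<Rightarrow> real \<Rightarrow> complex \<Rightarrow> real \<Rightarrow> complex" where
  "ell_line e h g q t = pt e (sqrt (h\<^sup>2 + g\<^sup>2) * Re (q * Complex 1 t)) (g * Im (q * Complex 1 t))"

definition hyp_line :: "conic \<Rightarrow> real \<Rightarrow> real \<Rightarrow> real \<Rightarrow> complex \<Rightarrow> real \<Rightarrow> complex" where
  "hyp_line e h g \<epsilon> q t = pt e (h * Re (q * Complex 1 t)) (\<epsilon> * g * t)"

definition ell_dir :: "conic \<Rightarrow> real \<Rightarrow> real \<Rightarrow> complex \<Rightarrow> complex" where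
  "ell_dir e h g q = (- sqrt (h\<^sup>2 + g\<^sup>2) * Im q) *\<^sub>R axis_dir e + (g * Re q) *\<^sub>R (\<i> * axis_dir e)"

definition hyp_dir :: "conic \<Rightarrow> real \<Rightarrow> real \<Rightarrow> real \<Rightarrow> complex \<Rightarrow> complex" where
  "hyp_dir e h g \<epsilon> q = (- h * Im q) *\<^sub>R axis_dir e + (\<epsilon> * g) *\<^sub>R (\<i> * axis_dir e)"

lemma ell_line_affine: "ell_line e h g q t = ell_line e h g q 0 + t *\<^sub>R ell_dir e h g q"
  by (simp add: ell_line_def ell_dir_def pt_def algebra_simps)

lemma hyp_line_affine: "hyp_line e h g \<epsilon> q t = hyp_line e h g \<epsilon> q 0 + t *\<^sub>R hyp_dir e h g \<epsilon> q"
  by (simp add: hyp_line_def hyp_dir_def pt_def algebra_simps)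

lemma norm_ell_dir:
  assumes "norm (axis_dir e) = 1" "norm q = 1"
  shows "(norm (ell_dir e h g q))\<^sup>2 = dir_square h g q"
proof -
  have "(norm (ell_dir e h g q))\<^sup>2 = (h\<^sup>2 + g\<^sup>2) * (Im q)\<^sup>2 + g\<^sup>2 * (Re q)\<^sup>2"
    unfolding power2_norm_eq_inner ell_dir_def inner_frame[OF assms(1)]
    by (simp add: power2_eq_square[symmetric] power_mult_distrib)
  also have "(Re q)\<^sup>2 = 1 - (Im q)\<^sup>2"
    using assms(2) norm_1_cmod by (simp add: eq_diff_eq)
  finally show ?thesis
    by (simp add: dir_square_def algebra_simps)
qed

lemma norm_hyp_dir:
  assumes "norm (axis_dir e) = 1" "\<epsilon> \<in> {1, - 1}"
  shows "(norm (hyp_dir e h g \<epsilon> q))\<^sup>2 = dir_square h g q"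
  unfolding power2_norm_eq_inner hyp_dir_def inner_frame[OF assms(1)]
  using assms(2) by (auto simp: power2_eq_square dir_square_def)

lemma dir_square_pos: "0 < g \<Longrightarrow> 0 < dir_square h g q"
  by (simp add: dir_square_def add_nonneg_pos)

lemma dir_nonzero:
  assumes "0 < g" "norm (axis_dir e) = 1"
  shows "norm q = 1 \<Longrightarrow> ell_dir e h g q \<noteq> 0" "\<epsilon> \<in> {1, - 1} \<Longrightarrow> hyp_dir e h g \<epsilon> q \<noteq> 0"
  using norm_ell_dir[OF assms(2)] norm_hyp_dir[OF assms(2)] dir_square_pos[OF assms(1)]
  by (metis norm_zero power_zero_numeral less_irrefl)+

lemma dist_ell_line:
  assumes "norm (axis_dir e) = 1" "norm q = 1"
  shows "(dist (ell_line e h g q x) (ell_line e h g q y))\<^sup>2 = (x - y)\<^sup>2 * dir_square h g q"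
proof -
  have "ell_line e h g q x - ell_line e h g q y = (x - y) *\<^sub>R ell_dir e h g q"
    using ell_line_affine[of e h g q x] ell_line_affine[of e h g q y] by (simp add: algebra_simps)
  then show ?thesis
    by (simp add: dist_norm power_mult_distrib norm_ell_dir[OF assms])
qed

lemma dist_hyp_line:
  assumes "norm (axis_dir e) = 1" "\<epsilon> \<in> {1, - 1}"
  shows "(dist (hyp_line e h g \<epsilon> q x) (hyp_line e h g \<epsilon> q y))\<^sup>2 = (x - y)\<^sup>2 * dir_square h g q"
proof -
  have "hyp_line e h g \<epsilon> q x - hyp_line e h g \<epsilon> q y = (x - y) *\<^sub>R hyp_dir e h g \<epsilon> q"
    using hyp_line_affine[of e h g \<epsilon> q x] hyp_line_affine[of e h g \<epsilon> q y]
    by (simp add: algebra_simps)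
  then show ?thesis
    by (simp add: dist_norm power_mult_distrib norm_hyp_dir[OF assms])
qed

lemma affine_hull_ell_line:
  "x \<noteq> y \<Longrightarrow> affine hull {ell_line e h g q x, ell_line e h g q y} = range (ell_line e h g q)"
  using affine_hull_param[of x y "ell_line e h g q 0" "ell_dir e h g q"]
  by (simp add: ell_line_affine[symmetric])

lemma affine_hull_hyp_line:
  "x \<noteq> y \<Longrightarrow> affine hull {hyp_line e h g \<epsilon> q x, hyp_line e h g \<epsilon> q y} = range (hyp_line e h g \<epsilon> q)"
  using affine_hull_param[of x y "hyp_line e h g \<epsilon> q 0" "hyp_dir e h g \<epsilon> q"]
  by (simp add: hyp_line_affine[symmetric])

lemma ell_line_inj:
  assumes "ell_family h g k e c"
  shows "ell_line e h g q x = ell_line e h g r y \<longleftrightarrow> q * Complex 1 x = r * Complex 1 y"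
proof -
  have "sqrt (h\<^sup>2 + g\<^sup>2) \<noteq> 0" "g \<noteq> 0"
    using assms by (auto simp: ell_family_def sum_power2_eq_zero_iff)
  then show ?thesis
    using assms unfolding ell_line_def
    by (subst pt_eq_iff) (auto simp: ell_family_def aligned_def complex_eq_iff simp del: times_complex.simps)
qed

text \<open>Flattening onto the hyperbola's plane forgets \<open>Im (q * Complex 1 t)\<close>, which
  Pythagoras then restores only up to sign. Reconstructing joints means resolving this sign.\<close>

lemma hyp_line_inj:
  assumes "hyp_family h g k e c"
  shows "hyp_line e h g \<epsilon> q x = hyp_line e h g \<delta> r y \<longleftrightarrow>
    Re (q * Complex 1 x) = Re (r * Complex 1 y) \<and> \<epsilon> * x = \<delta> * y"
proof -
  have "h \<noteq> 0" "g \<noteq> 0"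
    using assms by (auto simp: hyp_family_def)
  then show ?thesis
    using assms unfolding hyp_line_def
    by (subst pt_eq_iff) (auto simp: hyp_family_def aligned_def simp del: times_complex.simps)
qed

text \<open>The two ellipse equations have the same roots on a line, hence proportional leading
  coefficients; comparing them at \<open>Im q = 0\<close> gives the factor
  \<open>k / (g^2 + k)\<close>.\<close>

lemma quad_ell_line:
  assumes "ell_family h g k e c" "norm q = 1"
  shows "quad e (ell_line e h g q x) (ell_line e h g q y) =
    (x - y)\<^sup>2 * (k / (g\<^sup>2 + k) * line_quad h g k q)"
proof -
  have p: "h\<^sup>2 + g\<^sup>2 + k \<noteq> 0" "g\<^sup>2 + k \<noteq> 0" "k \<noteq> 0" and u: "norm (axis_dir e) = 1"
    and e: "sqA e = h\<^sup>2 + g\<^sup>2 + k" "sqB e = g\<^sup>2 + k"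
    using assms sum_squares_pos(1)[of k h g] sum_squares_pos(2)[of k g] by (auto simp: ell_family_def aligned_def)
  define X where "X = (Im q)\<^sup>2"
  have C: "(Re q)\<^sup>2 = 1 - X"
    using assms(2) norm_1_cmod by (simp add: eq_diff_eq X_def)
  have "quad e (ell_line e h g q x) (ell_line e h g q y) =
     ((sqrt (h\<^sup>2 + g\<^sup>2))\<^sup>2 * ((x - y)\<^sup>2 * X)) / (h\<^sup>2 + g\<^sup>2 + k) + (g\<^sup>2 * ((x - y)\<^sup>2 * (Re q)\<^sup>2)) / (g\<^sup>2 + k)"
    unfolding quad_def ell_line_def xc_pt[OF u] yc_pt[OF u] e X_def
      power_mult_distrib[symmetric] right_diff_distrib[symmetric]
    by (intro arg_cong2[of _ _ _ _ "(+)"] arg_cong2[of _ _ _ _ "(/)"] refl)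
      (simp_all add: power2_eq_square algebra_simps)
  also have "\<dots> = (x - y)\<^sup>2 * ((h\<^sup>2 + g\<^sup>2) * X / (h\<^sup>2 + g\<^sup>2 + k) + g\<^sup>2 * (1 - X) / (g\<^sup>2 + k))"
    unfolding C by (simp add: algebra_simps)
  also have "(h\<^sup>2 + g\<^sup>2) * X / (h\<^sup>2 + g\<^sup>2 + k) + g\<^sup>2 * (1 - X) / (g\<^sup>2 + k) =
      k / (g\<^sup>2 + k) * line_quad h g k q"
    unfolding line_quad_def X_def[symmetric] using p
    by (simp add: divide_simps) (simp add: power2_eq_square algebra_simps)
  finally show ?thesis .
qed

lemma quad_hyp_line:
  assumes "hyp_family h g k e c" "\<epsilon> \<in> {1, - 1}"
  shows "quad e (hyp_line e h g \<epsilon> q x) (hyp_line e h g \<epsilon> q y) = (x - y)\<^sup>2 * line_quad h g k q"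
proof -
  have u: "norm (axis_dir e) = 1" and e: "sqA e = h\<^sup>2 + g\<^sup>2 + k" "sqB e = k"
    using assms by (auto simp: hyp_family_def aligned_def)
  have "quad e (hyp_line e h g \<epsilon> q x) (hyp_line e h g \<epsilon> q y) =
     (h\<^sup>2 * ((x - y)\<^sup>2 * (Im q)\<^sup>2)) / (h\<^sup>2 + g\<^sup>2 + k) + (\<epsilon>\<^sup>2 * (g\<^sup>2 * (x - y)\<^sup>2)) / k"
    unfolding quad_def hyp_line_def xc_pt[OF u] yc_pt[OF u] e
      power_mult_distrib[symmetric] right_diff_distrib[symmetric]
    by (intro arg_cong2[of _ _ _ _ "(+)"] arg_cong2[of _ _ _ _ "(/)"] refl)
      (simp_all add: power2_eq_square algebra_simps)
  also have "\<epsilon>\<^sup>2 = 1"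
    using assms(2) by auto
  finally show ?thesis
    by (simp add: line_quad_def algebra_simps)
qed

lemma ell_line_on:
  assumes "ell_family h g k e c" "norm q = 1"
  shows "ell_line e h g q t \<in> points e \<longleftrightarrow> vertex_param h g k q t"
proof -
  have p: "0 < h" "0 < g" "0 < k" and u: "norm (axis_dir e) = 1"
    and e: "sqA e = h\<^sup>2 + g\<^sup>2 + k" "sqB e = g\<^sup>2 + k"
    using assms by (auto simp: ell_family_def aligned_def)
  show ?thesis
    unfolding vertex_param_ellipse[OF p assms(2)] ell_line_def pt_in_points[OF u] e power_mult_distrib
    by simp
qed

lemma hyp_line_on:
  assumes "hyp_family h g k e c" "\<epsilon> \<in> {1, - 1}"
  shows "hyp_line e h g \<epsilon> q t \<in> points e \<longleftrightarrow> vertex_param h g k q t"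
proof -
  have u: "norm (axis_dir e) = 1" and e: "sqA e = h\<^sup>2 + g\<^sup>2 + k" "sqB e = k"
    using assms by (auto simp: hyp_family_def aligned_def)
  have "\<epsilon>\<^sup>2 = 1"
    using assms(2) by auto
  then show ?thesis
    unfolding vertex_param_def hyp_line_def pt_in_points[OF u] e power_mult_distrib
    by simp
qed

lemma unit_tangent_iff:
  assumes "norm q = 1"
  shows "Re q * x + Im q * y = 1 \<longleftrightarrow> (\<exists>t. x = Re (q * Complex 1 t) \<and> y = Im (q * Complex 1 t))"
proof
  have q: "(Re q)\<^sup>2 + (Im q)\<^sup>2 = 1"
    using assms norm_1_cmod by blast
  assume a: "Re q * x + Im q * y = 1"
  \<comment> \<open>With \<open>z\<close> the point of coordinates \<open>x\<close> and
    \<open>y\<close>, this is \<open>Im (cnj q * z)\<close>; the assumption says that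
    \<open>Re (cnj q * z)\<close> is 1.\<close>
  define t where "t = Re q * y - Im q * x"
  have "Re (q * Complex 1 t) = Re q * (Re q * x + Im q * y) - Im q * t"
    unfolding a by simp
  also have "\<dots> = ((Re q)\<^sup>2 + (Im q)\<^sup>2) * x"
    by (simp add: t_def power2_eq_square algebra_simps)
  finally have 1: "x = Re (q * Complex 1 t)"
    using q by simp
  have "Im (q * Complex 1 t) = Im q * (Re q * x + Im q * y) + Re q * t"
    unfolding a by simp
  also have "\<dots> = ((Re q)\<^sup>2 + (Im q)\<^sup>2) * y"
    by (simp add: t_def power2_eq_square algebra_simps)
  finally have "y = Im (q * Complex 1 t)"
    using q by simp
  then show "\<exists>t. x = Re (q * Complex 1 t) \<and> y = Im (q * Complex 1 t)"
    using 1 by blast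
next
  have q: "(Re q)\<^sup>2 + (Im q)\<^sup>2 = 1"
    using assms norm_1_cmod by blast
  assume "\<exists>t. x = Re (q * Complex 1 t) \<and> y = Im (q * Complex 1 t)"
  then obtain t where t: "x = Re (q * Complex 1 t)" "y = Im (q * Complex 1 t)"
    by blast
  have "Re q * x + Im q * y = (Re q)\<^sup>2 + (Im q)\<^sup>2"
    unfolding t by (simp add: power2_eq_square algebra_simps)
  then show "Re q * x + Im q * y = 1"
    using q by simp
qed

lemma tangent_at_ell_line:
  assumes f: "ell_family h g k e c" and q: "norm q = 1"
  shows "tangent_at c (ell_line e h g q 0) = range (ell_line e h g q)"
proof (rule set_eqI)
  fix X
  define a where "a = sqrt (h\<^sup>2 + g\<^sup>2)"
  have p: "a > 0" "g > 0" "a\<^sup>2 = h\<^sup>2 + g\<^sup>2" and u: "norm (axis_dir e) = 1" and al: "aligned e c"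
    and c: "sqA c = a\<^sup>2" "sqB c = g\<^sup>2"
    using assms by (auto simp: ell_family_def aligned_def a_def add_pos_pos)
  define x y where "x = xc e X / a" and "y = yc e X / g"
  have X: "X = pt e (a * x) (g * y)"
    using pt_coords[OF u, of X] p by (simp add: x_def y_def)
  have "X \<in> tangent_at c (ell_line e h g q 0) \<longleftrightarrow>
      a * Re q * (a * x) / a\<^sup>2 + g * Im q * (g * y) / g\<^sup>2 = 1"
    unfolding X ell_line_def a_def[symmetric] aligned_tangent_at[OF al] c by simp
  also have "\<dots> \<longleftrightarrow> Re q * x + Im q * y = 1"
    using p(1,2) by (simp add: power2_eq_square)
  also have "\<dots> \<longleftrightarrow> X \<in> range (ell_line e h g q)"
    unfolding unit_tangent_iff[OF q] X ell_line_def a_def[symmetric] image_iff pt_eq_iff[OF u]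
    using p by (simp add: mult_cancel_left del: times_complex.simps)
  finally show "X \<in> tangent_at c (ell_line e h g q 0) \<longleftrightarrow> X \<in> range (ell_line e h g q)" .
qed

lemma ell_line_on_caustic:
  assumes f: "ell_family h g k e c" and q: "norm q = 1"
  shows "ell_line e h g q t \<in> points c \<longleftrightarrow> t = 0"
proof -
  define a where "a = sqrt (h\<^sup>2 + g\<^sup>2)"
  have p: "a > 0" "g > 0" "a\<^sup>2 = h\<^sup>2 + g\<^sup>2" and al: "aligned e c"
    and c: "sqA c = a\<^sup>2" "sqB c = g\<^sup>2"
    using assms by (auto simp: ell_family_def aligned_def a_def add_pos_pos)
  have "ell_line e h g q t \<in> points c \<longleftrightarrow> (Re (q * Complex 1 t))\<^sup>2 + (Im (q * Complex 1 t))\<^sup>2 = 1"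
    unfolding ell_line_def a_def[symmetric] aligned_points[OF al] c power_mult_distrib
    using p by simp
  then show ?thesis
    unfolding unit_tangent_square[OF q] by simp
qed

lemma touches_ell_line:
  assumes f: "ell_family h g k e c" and q: "norm q = 1"
  shows "touches c (range (ell_line e h g q)) T \<longleftrightarrow> T = ell_line e h g q 0"
proof
  assume t: "touches c (range (ell_line e h g q)) T"
  then have "T \<in> tangent_at c T"
    by (simp add: touches_def points_def tangent_at_def power2_eq_square)
  then obtain t where "T = ell_line e h g q t"
    using t by (auto simp: touches_def)
  then show "T = ell_line e h g q 0"
    using t ell_line_on_caustic[OF f q] by (auto simp: touches_def)
next
  assume "T = ell_line e h g q 0"
  then show "touches c (range (ell_line e h g q)) T"
    using tangent_at_ell_line[OF f q] ell_line_on_caustic[OF f q] by (simp add: touches_def)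
qed

lemma tangent_line_ellipse:
  assumes f: "ell_family h g k e c" and L: "tangent_line c L"
  obtains q where "norm q = 1" "L = range (ell_line e h g q)"
proof -
  define a where "a = sqrt (h\<^sup>2 + g\<^sup>2)"
  have p: "a > 0" "g > 0" "a\<^sup>2 = h\<^sup>2 + g\<^sup>2" and u: "norm (axis_dir e) = 1" and al: "aligned e c"
    and c: "sqA c = a\<^sup>2" "sqB c = g\<^sup>2"
    using assms by (auto simp: ell_family_def aligned_def a_def add_pos_pos)
  have "asymptotes c = {}"
    by (simp add: asymptotes_def is_hyperbola_def c)
  then obtain T where T: "T \<in> points c" "L = tangent_at c T"
    using L by (auto simp: tangent_line_def touches_def)
  define q where "q = Complex (xc e T / a) (yc e T / g)"
  have Teq: "T = ell_line e h g q 0"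
    using pt_coords[OF u, of T] p by (simp add: ell_line_def q_def a_def[symmetric])
  have "(Re q)\<^sup>2 + (Im q)\<^sup>2 = 1"
    using T(1) aligned_points[OF al, of "xc e T" "yc e T"] pt_coords[OF u, of T]
    by (simp add: q_def c power_divide)
  then have q: "norm q = 1"
    using norm_1_cmod by blast
  show ?thesis
    using that[OF q] T(2) tangent_at_ell_line[OF f q] Teq by simp
qed

lemma hyp_coords:
  assumes "hyp_family h g k e c" "\<epsilon> \<in> {1, - 1}"
  obtains x y where "X = pt e (h * x) (\<epsilon> * g * y)"
proof
  have u: "norm (axis_dir e) = 1"
    using assms by (auto simp: hyp_family_def aligned_def)
  show "X = pt e (h * (xc e X / h)) (\<epsilon> * g * (\<epsilon> * yc e X / g))"
    using pt_coords[OF u, of X] assms by (auto simp: hyp_family_def)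
qed

lemma hyp_line_mem:
  assumes "hyp_family h g k e c" "\<epsilon> \<in> {1, - 1}"
  shows "pt e (h * x) (\<epsilon> * g * y) \<in> range (hyp_line e h g \<epsilon> q) \<longleftrightarrow> x = Re q - Im q * y"
proof -
  have "norm (axis_dir e) = 1" "h \<noteq> 0" "g \<noteq> 0"
    using assms by (auto simp: hyp_family_def aligned_def)
  then show ?thesis
    using assms(2) by (auto simp: hyp_line_def image_iff pt_eq_iff)
qed

text \<open>On the line the hyperbola reads \<open>w^2 - t^2 = 1\<close>, which Pythagoras turns
  into the vanishing of the square of \<open>Im (q * Complex 1 t)\<close>: a double root, hence a
  contact. If \<open>Re q = 0\<close> there is no such \<open>t\<close>, and the line is an
  asymptote.\<close>

lemma touches_hyp_line:
  assumes f: "hyp_family h g k e c" and \<epsilon>: "\<epsilon> \<in> {1, - 1}" and q: "norm q = 1"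
  shows "touches c (range (hyp_line e h g \<epsilon> q)) (hyp_line e h g \<epsilon> q t) \<longleftrightarrow> Im (q * Complex 1 t) = 0"
proof -
  have p: "h > 0" "g > 0" and al: "aligned e c" and c: "sqA c = h\<^sup>2" "sqB c = - g\<^sup>2"
    using f by (auto simp: hyp_family_def)
  have \<epsilon>2: "\<epsilon>\<^sup>2 = 1"
    using \<epsilon> by auto
  define w where "w = Re (q * Complex 1 t)"
  have "hyp_line e h g \<epsilon> q t \<in> points c \<longleftrightarrow> w\<^sup>2 - t\<^sup>2 = 1"
    unfolding hyp_line_def w_def[symmetric] aligned_points[OF al] c power_mult_distrib \<epsilon>2
    using p by simp
  also have "\<dots> \<longleftrightarrow> Im (q * Complex 1 t) = 0"
    using unit_tangent_square[OF q, of t] unfolding w_def[symmetric]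
    by (smt (verit) power_eq_0_iff zero_power2)
  finally have on: "hyp_line e h g \<epsilon> q t \<in> points c \<longleftrightarrow> Im (q * Complex 1 t) = 0" .
  have "range (hyp_line e h g \<epsilon> q) = tangent_at c (hyp_line e h g \<epsilon> q t)"
    if im: "Im (q * Complex 1 t) = 0"
  proof (rule set_eqI)
    fix X
    obtain x y where X: "X = pt e (h * x) (\<epsilon> * g * y)"
      using hyp_coords[OF f \<epsilon>] .
    have w2: "w\<^sup>2 = 1 + t\<^sup>2"
      using unit_tangent_square[OF q, of t] im by (simp add: w_def)
    then have w: "w \<noteq> 0"
      by (smt (verit) zero_le_power2 zero_power2)
    have i: "Im q = - t * Re q"
      using im by (simp add: algebra_simps eq_neg_iff_add_eq_0)
    have wC: "w = Re q * (1 + t\<^sup>2)"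
      unfolding w_def by (simp add: i power2_eq_square algebra_simps)
    have "Re q * w = 1"
      using wC w w2 by (metis mult.commute mult.left_commute mult_cancel_left power2_eq_square mult_1)
    then have "w * (Re q - Im q * y) = 1 + t * y"
      unfolding i by (simp add: algebra_simps)
    moreover have "x = Re q - Im q * y \<longleftrightarrow> w * x = w * (Re q - Im q * y)"
      using w by simp
    ultimately have "x = Re q - Im q * y \<longleftrightarrow> w * x - t * y = 1"
      by linarith
    moreover have "X \<in> tangent_at c (hyp_line e h g \<epsilon> q t) \<longleftrightarrow> w * x - t * y = 1"
      unfolding X hyp_line_def w_def[symmetric] aligned_tangent_at[OF al] c
      using p \<epsilon> by (auto simp: power2_eq_square)
    ultimately show "X \<in> range (hyp_line e h g \<epsilon> q) \<longleftrightarrow> X \<in> tangent_at c (hyp_line e h g \<epsilon> q t)"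
      using hyp_line_mem[OF f \<epsilon>] X by simp
  qed
  then show ?thesis
    using on by (auto simp: touches_def)
qed

text \<open>For \<open>Re q = 0\<close> the line passes through the centre and \<open>Im q\<close>
  fixes its slope. The factor \<open>\<epsilon>\<close> in \<open>q\<close> compensates the one in
  the ordinates.\<close>

lemma hyp_line_asymptote:
  assumes f: "hyp_family h g k e c" and \<epsilon>: "\<epsilon> \<in> {1, - 1}" and \<sigma>: "\<sigma> \<in> {1, - 1}"
  shows "range (hyp_line e h g \<epsilon> (Complex 0 (- \<sigma> * \<epsilon>))) =
    {X. xc e X / sqrt (sqA c) = \<sigma> * (yc e X / sqrt (- sqB c))}"
proof (rule set_eqI)
  fix X
  have p: "h > 0" "g > 0" and u: "norm (axis_dir e) = 1" and c: "sqA c = h\<^sup>2" "sqB c = - g\<^sup>2"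
    using f by (auto simp: hyp_family_def aligned_def)
  obtain x y where X: "X = pt e (h * x) (\<epsilon> * g * y)"
    using hyp_coords[OF f \<epsilon>] .
  show "X \<in> range (hyp_line e h g \<epsilon> (Complex 0 (- \<sigma> * \<epsilon>))) \<longleftrightarrow>
      X \<in> {X. xc e X / sqrt (sqA c) = \<sigma> * (yc e X / sqrt (- sqB c))}"
    unfolding X hyp_line_mem[OF f \<epsilon>] using p \<epsilon> \<sigma> by (auto simp: xc_pt[OF u] yc_pt[OF u] c)
qed

lemma tangent_line_hyp_line:
  assumes f: "hyp_family h g k e c" and \<epsilon>: "\<epsilon> \<in> {1, - 1}" and q: "norm q = 1"
  shows "tangent_line c (range (hyp_line e h g \<epsilon> q))"
proof (cases "Re q = 0")
  case True
  then have "\<bar>Im q\<bar> = 1"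
    using q by (simp add: cmod_eq_Im)
  then have "q = Complex 0 (- (- \<epsilon> * Im q) * \<epsilon>)" "- \<epsilon> * Im q \<in> {1, - 1}"
    using True \<epsilon> by (auto simp: complex_eq_iff)
  then have "range (hyp_line e h g \<epsilon> q) \<in> asymptotes c"
    using hyp_line_asymptote[OF f \<epsilon>]
    unfolding aligned_asymptotes[OF hyp_familyD(5,7)[OF f]]
    by metis
  then show ?thesis
    by (simp add: tangent_line_def)
next
  case False
  then have "Im (q * Complex 1 (- Im q / Re q)) = 0"
    by simp
  then have "touches c (range (hyp_line e h g \<epsilon> q)) (hyp_line e h g \<epsilon> q (- Im q / Re q))"
    using touches_hyp_line[OF assms] by blast
  then show ?thesis
    unfolding tangent_line_def by blast
qed

text \<open>Both families of generators flatten onto the same set of tangents, so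
  \<open>\<epsilon>\<close> can be prescribed; the alternation of \<open>eps\<close> can then be
  imposed on any given billiard.\<close>

lemma tangent_line_hyperbola:
  assumes f: "hyp_family h g k e c" and \<epsilon>: "\<epsilon> \<in> {1, - 1}" and L: "tangent_line c L"
  obtains q where "norm q = 1" "L = range (hyp_line e h g \<epsilon> q)"
proof -
  have p: "h > 0" "g > 0" and al: "aligned e c" and c: "sqA c = h\<^sup>2" "sqB c = - g\<^sup>2"
    using f by (auto simp: hyp_family_def)
  consider T where "touches c L T" | "L \<in> asymptotes c"
    using L by (auto simp: tangent_line_def)
  then show ?thesis
  proof cases
    case 1
    obtain w t where T: "T = pt e (h * w) (\<epsilon> * g * t)"
      using hyp_coords[OF f \<epsilon>] .
    have "T \<in> points c"
      using 1 by (simp add: touches_def)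
    then have w2: "w\<^sup>2 = 1 + t\<^sup>2"
      using p \<epsilon> unfolding T aligned_points[OF al] c by (auto simp: power_mult_distrib)
    then have w: "w \<noteq> 0"
      by (smt (verit) zero_le_power2 zero_power2)
    \<comment> \<open>At the contact point \<open>q * Complex 1 t\<close> must be the real number
      \<open>w\<close>; solving for \<open>q\<close> with \<open>w^2 = 1 + t^2\<close> gives this
      quotient.\<close>
    define q where "q = Complex (1 / w) (- t / w)"
    have "(Re q)\<^sup>2 + (Im q)\<^sup>2 = (1 + t\<^sup>2) / w\<^sup>2"
      by (simp add: q_def power_divide add_divide_distrib)
    moreover have "1 + t\<^sup>2 \<noteq> 0"
      using w w2 by (metis power_not_zero)
    ultimately have q: "norm q = 1"
      unfolding norm_1_cmod w2 by simp
    have im: "Im (q * Complex 1 t) = 0"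
      by (simp add: q_def)
    have "Re (q * Complex 1 t) = (1 + t\<^sup>2) / w"
      by (simp add: q_def power2_eq_square add_divide_distrib)
    also have "\<dots> = w"
      using w w2 by (simp add: power2_eq_square field_simps)
    finally have "T = hyp_line e h g \<epsilon> q t"
      by (simp add: T hyp_line_def del: times_complex.simps)
    then have "touches c (range (hyp_line e h g \<epsilon> q)) T"
      using touches_hyp_line[OF f \<epsilon> q] im by simp
    then show ?thesis
      using that[OF q] 1 by (simp add: touches_def)
  next
    case 2
    then obtain \<sigma> where \<sigma>: "\<sigma> \<in> {1, - 1}"
      and "L = {X. xc e X / sqrt (sqA c) = \<sigma> * (yc e X / sqrt (- sqB c))}"
      using aligned_asymptotes[OF al hyp_familyD(7)[OF f]] by blast
    then have "L = range (hyp_line e h g \<epsilon> (Complex 0 (- \<sigma> * \<epsilon>)))"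
      using hyp_line_asymptote[OF f \<epsilon> \<sigma>] by simp
    moreover have "norm (Complex 0 (- \<sigma> * \<epsilon>)) = 1"
      using \<epsilon> \<sigma> by (auto simp: cmod_eq_Im)
    ultimately show ?thesis
      using that by blast
  qed
qed

text \<open>This value and \<open>hyp_joachimsthal\<close> have one shape: the difference of the
  squared semiaxes of ellipse and caustic (\<open>k\<close> here, \<open>g^2 + k\<close> there),
  divided by the product of the squared semiaxes of the ellipse.\<close>

definition ell_joachimsthal :: "real \<Rightarrow> real \<Rightarrow> real \<Rightarrow> real" where
  "ell_joachimsthal h g k = k / ((h\<^sup>2 + g\<^sup>2 + k) * (g\<^sup>2 + k))"

definition hyp_joachimsthal :: "real \<Rightarrow> real \<Rightarrow> real \<Rightarrow> real" where
  "hyp_joachimsthal h g k = (g\<^sup>2 + k) / ((h\<^sup>2 + g\<^sup>2 + k) * k)"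

lemma quad_hyp_line_square:
  assumes f: "hyp_family h g k e c" and \<epsilon>: "\<epsilon> \<in> {1, - 1}" and q: "norm q = 1"
    and "vertex_param h g k q x" "vertex_param h g k q y" "x \<noteq> y"
  shows "(quad e (hyp_line e h g \<epsilon> q x) (hyp_line e h g \<epsilon> q y))\<^sup>2 =
    4 * hyp_joachimsthal h g k * (dist (hyp_line e h g \<epsilon> q x) (hyp_line e h g \<epsilon> q y))\<^sup>2"
proof -
  have p: "0 < h" "0 < g" "0 < k" and u: "norm (axis_dir e) = 1"
    using f by (auto simp: hyp_family_def aligned_def)
  have "(quad e (hyp_line e h g \<epsilon> q x) (hyp_line e h g \<epsilon> q y))\<^sup>2 =
      (x - y)\<^sup>2 * ((x - y)\<^sup>2 * (line_quad h g k q)\<^sup>2)"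
    unfolding quad_hyp_line[OF f \<epsilon>] by (simp add: power_mult_distrib power2_eq_square)
  then show ?thesis
    unfolding vertex_params(2)[OF p q assms(4-6)] dist_hyp_line[OF u \<epsilon>] hyp_joachimsthal_def
    by simp
qed

lemma quad_ell_line_square:
  assumes f: "ell_family h g k e c" and q: "norm q = 1"
    and "vertex_param h g k q x" "vertex_param h g k q y" "x \<noteq> y"
  shows "(quad e (ell_line e h g q x) (ell_line e h g q y))\<^sup>2 =
    4 * ell_joachimsthal h g k * (dist (ell_line e h g q x) (ell_line e h g q y))\<^sup>2"
proof -
  have p: "0 < h" "0 < g" "0 < k" and u: "norm (axis_dir e) = 1"
    using f by (auto simp: ell_family_def aligned_def)
  define b2 where "b2 = g\<^sup>2 + k"
  define a2 where "a2 = h\<^sup>2 + g\<^sup>2 + k"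
  have ab: "a2 > 0" "b2 > 0"
    using sum_squares_pos p(3) by (auto simp: a2_def b2_def)
  have "(quad e (ell_line e h g q x) (ell_line e h g q y))\<^sup>2 =
      (k / b2)\<^sup>2 * ((x - y)\<^sup>2 * ((x - y)\<^sup>2 * (line_quad h g k q)\<^sup>2))"
    unfolding quad_ell_line[OF f q] b2_def by (simp add: power_mult_distrib power2_eq_square)
  also have "\<dots> = ((k / b2)\<^sup>2 * (b2 / (a2 * k))) * 4 * ((x - y)\<^sup>2 * dir_square h g q)"
    unfolding vertex_params(2)[OF p q assms(3-5)] a2_def b2_def
    by simp
  also have "(k / b2)\<^sup>2 * (b2 / (a2 * k)) = k / (a2 * b2)"
    using ab p by (simp add: power2_eq_square)
  finally show ?thesis
    unfolding dist_ell_line[OF u q] ell_joachimsthal_def a2_def b2_def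
    by simp
qed

text \<open>Confocal conics meet at right angles, so at a common point the tangent of the hyperbola
  is the normal of the ellipse; there alone the billiard can run back. In the proof both conditions
  are reduced to \<open>(h^2 + g^2) * t^2 = k\<close>.\<close>

lemma hyp_normal_square:
  assumes f: "hyp_family h g k e c" and \<epsilon>: "\<epsilon> \<in> {1, - 1}" and q: "norm q = 1"
    and v: "vertex_param h g k q t"
  shows "inner (normal_vec e (hyp_line e h g \<epsilon> q t)) (normal_vec e (hyp_line e h g \<epsilon> q t)) =
      hyp_joachimsthal h g k \<longleftrightarrow> Im (q * Complex 1 t) = 0"
proof -
  have p: "0 < h" "0 < g" "0 < k" and u: "norm (axis_dir e) = 1"
    and e: "sqA e = h\<^sup>2 + g\<^sup>2 + k" "sqB e = k"
    using f by (auto simp: hyp_family_def aligned_def)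
  have \<epsilon>2: "\<epsilon>\<^sup>2 = 1"
    using \<epsilon> by auto
  define a2 where "a2 = h\<^sup>2 + g\<^sup>2 + k"
  define X where "X = (Re (q * Complex 1 t))\<^sup>2"
  define Y where "Y = (Im (q * Complex 1 t))\<^sup>2"
  have a2: "a2 > 0"
    using sum_squares_pos p(3) by (auto simp: a2_def)
  have v': "h\<^sup>2 * X * k + g\<^sup>2 * t\<^sup>2 * a2 = a2 * k"
    using v a2 p unfolding vertex_param_def X_def[symmetric] a2_def[symmetric]
    by (simp add: field_simps)
  have XY: "X = 1 + t\<^sup>2 - Y"
    using unit_tangent_square[OF q, of t] by (simp add: X_def Y_def)
  have "((h\<^sup>2 + g\<^sup>2) * t\<^sup>2 - k) * (g\<^sup>2 + k) = h\<^sup>2 * k * Y"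
    using v' unfolding XY a2_def by (simp add: algebra_simps)
  moreover have "g\<^sup>2 + k > 0" "h\<^sup>2 * k > 0"
    using sum_squares_pos p by auto
  ultimately have 1: "Y = 0 \<longleftrightarrow> (h\<^sup>2 + g\<^sup>2) * t\<^sup>2 = k"
    by (metis eq_iff_diff_eq_0 less_irrefl mult_eq_0_iff)
  have "inner (normal_vec e (hyp_line e h g \<epsilon> q t)) (normal_vec e (hyp_line e h g \<epsilon> q t)) =
      h\<^sup>2 * X / a2\<^sup>2 + g\<^sup>2 * t\<^sup>2 / k\<^sup>2"
    unfolding normal_vec_square[OF u] e hyp_line_def xc_pt[OF u] yc_pt[OF u] X_def
      a2_def[symmetric] power_divide power_mult_distrib \<epsilon>2 by simp
  also have "\<dots> = (h\<^sup>2 * X * k) / (a2\<^sup>2 * k) + g\<^sup>2 * t\<^sup>2 / k\<^sup>2"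
    using p by simp
  also have "h\<^sup>2 * X * k = a2 * k - g\<^sup>2 * t\<^sup>2 * a2"
    using v' by simp
  also have "(a2 * k - g\<^sup>2 * t\<^sup>2 * a2) / (a2\<^sup>2 * k) + g\<^sup>2 * t\<^sup>2 / k\<^sup>2 =
      (k\<^sup>2 + g\<^sup>2 * ((h\<^sup>2 + g\<^sup>2) * t\<^sup>2)) / (a2 * k\<^sup>2)"
    using a2 p by (simp add: divide_simps) (simp add: a2_def power2_eq_square algebra_simps)
  also have "\<dots> = hyp_joachimsthal h g k \<longleftrightarrow> (h\<^sup>2 + g\<^sup>2) * t\<^sup>2 = k"
    unfolding hyp_joachimsthal_def a2_def[symmetric]
  proof -
    define Z where "Z = (h\<^sup>2 + g\<^sup>2) * t\<^sup>2"
    have "(g\<^sup>2 + k) / (a2 * k) = (k\<^sup>2 + g\<^sup>2 * k) / (a2 * k\<^sup>2)"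
      using p by (simp add: power2_eq_square algebra_simps add_divide_distrib)
    then show "(k\<^sup>2 + g\<^sup>2 * ((h\<^sup>2 + g\<^sup>2) * t\<^sup>2)) / (a2 * k\<^sup>2) = (g\<^sup>2 + k) / (a2 * k) \<longleftrightarrow>
        (h\<^sup>2 + g\<^sup>2) * t\<^sup>2 = k"
      unfolding Z_def[symmetric] using a2 p by simp
  qed
  finally show ?thesis
    using 1 by (simp add: Y_def)
qed

text \<open>The integral lies below \<open>1 / a2\<close>, and the squared length of the normal
  never does. So no tangent of the elliptic caustic is orthogonal to \<open>e\<close>.\<close>

lemma ell_normal_square:
  assumes f: "ell_family h g k e c" and X: "X \<in> points e"
  shows "inner (normal_vec e X) (normal_vec e X) > ell_joachimsthal h g k"
proof -
  have p: "0 < h" "0 < g" "0 < k" and u: "norm (axis_dir e) = 1"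
    and e: "sqA e = h\<^sup>2 + g\<^sup>2 + k" "sqB e = g\<^sup>2 + k"
    using f by (auto simp: ell_family_def aligned_def)
  define b2 where "b2 = g\<^sup>2 + k"
  define a2 where "a2 = h\<^sup>2 + g\<^sup>2 + k"
  have ab: "a2 > 0" "b2 > k" "a2 > b2" "b2 > 0"
    using sum_squares_pos p by (auto simp: a2_def b2_def)
  have "ell_joachimsthal h g k = k / b2 * (1 / a2)"
    unfolding ell_joachimsthal_def a2_def[symmetric] b2_def[symmetric] by simp
  also have "\<dots> < 1 / a2"
    using ab p by (simp add: field_simps)
  also have "\<dots> = ((xc e X)\<^sup>2 / a2) / a2 + ((yc e X)\<^sup>2 / b2) / a2"
    using X e unfolding points_def a2_def b2_def by (metis (mono_tags) add_divide_distrib mem_Collect_eq)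
  also have "\<dots> \<le> ((xc e X)\<^sup>2 / a2) / a2 + ((yc e X)\<^sup>2 / b2) / b2"
    using ab by (intro add_left_mono divide_left_mono) auto
  also have "\<dots> = inner (normal_vec e X) (normal_vec e X)"
    unfolding normal_vec_square[OF u] e a2_def b2_def by (simp add: power2_eq_square)
  finally show ?thesis .
qed

subsection \<open>Billiards as sequences of tangents\<close>

lemma sgn_opposite:
  fixes D E :: "'a :: real_normed_vector"
  assumes "sgn (a *\<^sub>R D) = - sgn (b *\<^sub>R E)" "0 < a * b" "D \<noteq> 0" "E \<noteq> 0"
  obtains \<mu> where "\<mu> > 0" "D = (- \<mu>) *\<^sub>R E"
proof
  have "sgn a = sgn b" "sgn a \<noteq> 0"
    using assms(2) by (auto simp: sgn_if zero_less_mult_iff)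
  then have s: "sgn D = - sgn E"
    using assms(1) unfolding sgn_scaleR
    by (metis real_vector.scale_left_imp_eq scaleR_minus_right)
  have "D = norm D *\<^sub>R sgn D"
    using assms(3) by (simp add: sgn_div_norm)
  also have "\<dots> = (- (norm D / norm E)) *\<^sub>R E"
    unfolding s using assms(4) by (simp add: sgn_div_norm divide_inverse)
  finally show "D = (- (norm D / norm E)) *\<^sub>R E" .
  show "norm D / norm E > 0"
    using assms by simp
qed

lemma chain_same_sign:
  assumes "chain h g k q s"
  shows "0 < s i * s j"
proof -
  have p: "0 < s i * s (i + 1)" for i
    using chainD[OF assms] by blast
  have "(0 < s j) = (0 < s i) \<and> (s j < 0) = (s i < 0)"
  proof (induction j rule: int_induct[where k = i])
    case base
    then show ?case by simp
  next
    case (step1 j)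
    then show ?case
      using p[of j] by (auto simp: zero_less_mult_iff)
  next
    case (step2 j)
    then show ?case
      using p[of "j - 1"] by (auto simp: zero_less_mult_iff)
  qed
  then show ?thesis
    using p[of i] by (auto simp: zero_less_mult_iff)
qed

lemma chain_add_same_sign:
  assumes "chain h g k q s"
  shows "0 < (s i + s j) * (s i' + s j')" "s i + s j \<noteq> 0"
proof -
  have "0 < s i * s i'" "0 < s i * s j'" "0 < s j * s i'" "0 < s j * s j'" "0 < s i * s j"
    using chain_same_sign[OF assms] by blast+
  moreover have "(s i + s j) * (s i' + s j') = s i * s i' + s i * s j' + s j * s i' + s j * s j'"
    by (simp add: algebra_simps)
  ultimately show "0 < (s i + s j) * (s i' + s j')" "s i + s j \<noteq> 0"
    by (linarith, auto simp: zero_less_mult_iff)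
qed

definition ell_rep :: "conic \<Rightarrow> real \<Rightarrow> real \<Rightarrow> (int \<Rightarrow> complex) \<Rightarrow> (int \<Rightarrow> real) \<Rightarrow> (int \<Rightarrow> complex) \<Rightarrow> bool" where
  "ell_rep e h g q s P \<longleftrightarrow> (\<forall>i. P i = ell_line e h g (q i) (- s i))"

definition eps :: "int \<Rightarrow> real" where
  "eps i = (if even i then 1 else - 1)"

lemma eps_cases: "eps i \<in> {1, - 1}"
  by (simp add: eps_def)

lemma eps_simps [simp]: "eps (i + 1) = - eps i" "eps (i - 1) = - eps i" "eps i * eps i = 1" "eps i \<noteq> 0"
  by (simp_all add: eps_def)

definition hyp_rep :: "conic \<Rightarrow> real \<Rightarrow> real \<Rightarrow> (int \<Rightarrow> complex) \<Rightarrow> (int \<Rightarrow> real) \<Rightarrow> (int \<Rightarrow> complex) \<Rightarrow> bool" where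
  "hyp_rep e h g q s P \<longleftrightarrow> (\<forall>i. P i = hyp_line e h g (eps i) (q i) (- s i))"

lemma ell_repD:
  assumes "chain h g k q s" "ell_rep e h g q s P"
  shows "P i = ell_line e h g (q i) (- s i)" "P (i + 1) = ell_line e h g (q i) (s (i + 1))"
    "side_line P i = range (ell_line e h g (q i))"
proof -
  show 1: "P i = ell_line e h g (q i) (- s i)"
    using assms(2) by (simp add: ell_rep_def)
  have "P (i + 1) = ell_line e h g (q (i + 1)) (- s (i + 1))"
    using assms(2) by (simp add: ell_rep_def)
  then show 2: "P (i + 1) = ell_line e h g (q i) (s (i + 1))"
    unfolding ell_line_def chainD(3)[OF assms(1), symmetric] .
  show "side_line P i = range (ell_line e h g (q i))"
    unfolding side_line_def 1 2 using affine_hull_ell_line chainD(7)[OF assms(1)] by blast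
qed

lemma hyp_repD:
  assumes "chain h g k q s" "hyp_rep e h g q s P"
  shows "P i = hyp_line e h g (eps i) (q i) (- s i)"
    "P (i + 1) = hyp_line e h g (eps i) (q i) (s (i + 1))"
    "side_line P i = range (hyp_line e h g (eps i) (q i))"
proof -
  show 1: "P i = hyp_line e h g (eps i) (q i) (- s i)"
    using assms(2) by (simp add: hyp_rep_def)
  have "P (i + 1) = hyp_line e h g (eps (i + 1)) (q (i + 1)) (- s (i + 1))"
    using assms(2) by (simp only: hyp_rep_def)
  then show 2: "P (i + 1) = hyp_line e h g (eps i) (q i) (s (i + 1))"
    unfolding hyp_line_def chainD(3)[OF assms(1), symmetric] by simp
  show "side_line P i = range (hyp_line e h g (eps i) (q i))"
    unfolding side_line_def 1 2 using affine_hull_hyp_line chainD(7)[OF assms(1)] by blast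
qed

lemma real_scaled_unit:
  assumes "norm q = 1" "norm r = 1" "q = (- \<mu>) *\<^sub>R (r :: complex)" "\<mu> > 0"
  shows "q = - r"
proof -
  have "norm q = \<mu> * norm r"
    using assms(3,4) by simp
  then show ?thesis
    using assms by simp
qed

text \<open>Tangents at antipodal points of the circle are parallel, whereas consecutive ones share
  a vertex.\<close>

lemma chain_not_opposite:
  assumes "chain h g k q s"
  shows "q i \<noteq> - q (i - 1)"
proof
  assume o: "q i = - q (i - 1)"
  have "q (i - 1) * Complex 1 (s i) = q i * Complex 1 (- s i)"
    using chainD(3)[OF assms, of "i - 1"] by simp
  then have "q (i - 1) * (Complex 1 (s i) + Complex 1 (- s i)) = 0"
    unfolding o by (simp only: distrib_left mult_minus_left) simp
  moreover have "Complex 1 (s i) + Complex 1 (- s i) \<noteq> 0"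
    by (simp add: complex_eq_iff)
  ultimately show False
    using chainD(8)[OF assms] by simp
qed

lemma elliptic_billiardI:
  assumes f: "ell_family h g k e c" and ch: "chain h g k q s" and P: "ell_rep e h g q s P"
  shows "elliptic_billiard e c P"
proof -
  note fD = ell_familyD[OF f] and cD = chainD[OF ch] and PD = ell_repD[OF ch P]
  have on: "P i \<in> points e" for i
    unfolding PD(1) ell_line_on[OF f cD(1)] using cD(4) .
  have ne: "P i \<noteq> P (i + 1)" for i
    unfolding PD(1)[of i] PD(2)[of i] ell_line_inj[OF f] using cD(7,8)[of i] by simp
  have J: "(quad e (P i) (P (i + 1)))\<^sup>2 = 4 * ell_joachimsthal h g k * (dist (P i) (P (i + 1)))\<^sup>2" for i
    unfolding PD(1)[of i] PD(2)[of i] using quad_ell_line_square[OF f cD(1) cD(4) cD(5) cD(7)] .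
  have diff: "P (i + 1) - P i = (s (i + 1) + s i) *\<^sub>R ell_dir e h g (q i)" for i
    unfolding PD(1)[of i] PD(2)[of i]
    using ell_line_affine[of e h g "q i" "- s i"] ell_line_affine[of e h g "q i" "s (i + 1)"]
    by (simp add: algebra_simps)
  have "billiard e P"
  proof (rule billiardI[OF fD(6), where P = P and J = "ell_joachimsthal h g k"])
    fix i
    show "P i \<in> points e" "P i \<noteq> P (i + 1)"
      "(quad e (P i) (P (i + 1)))\<^sup>2 = 4 * ell_joachimsthal h g k * (dist (P i) (P (i + 1)))\<^sup>2"
      by (rule on, rule ne, rule J)
  next
    fix i
    assume a: "sgn (P (i + 1) - P i) = - sgn (P i - P (i - 1))"
    \<comment> \<open>Opposite directions of the sides would, after unscaling, make consecutive
      contact points antipodal. The reversal case is therefore empty.\<close>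
    obtain \<mu> where \<mu>: "\<mu> > 0" "ell_dir e h g (q i) = (- \<mu>) *\<^sub>R ell_dir e h g (q (i - 1))"
      using sgn_opposite[OF a[unfolded diff diff[of "i - 1", simplified]]]
        chain_add_same_sign[OF ch] dir_nonzero(1)[OF fD(2,4) cD(1)] by metis
    define a where "a = sqrt (h\<^sup>2 + g\<^sup>2)"
    have a: "a > 0"
      using fD by (simp add: a_def add_pos_pos)
    have "pt e (- a * Im (q i)) (g * Re (q i)) =
        pt e (- \<mu> * (- a * Im (q (i - 1)))) (- \<mu> * (g * Re (q (i - 1))))"
      using arg_cong[OF \<mu>(2)[unfolded ell_dir_def, folded a_def], of "\<lambda>z. centre e + z"]
      by (simp add: pt_def algebra_simps)
    then have "a * Im (q i) = a * (- \<mu> * Im (q (i - 1)))" "g * Re (q i) = g * (- \<mu> * Re (q (i - 1)))"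
      unfolding pt_eq_iff[OF fD(4)] by (auto simp: algebra_simps)
    then have "q i = (- \<mu>) *\<^sub>R q (i - 1)"
      unfolding mult_cancel_left using a fD(2) by (auto simp: complex_eq_iff)
    then have "q i = - q (i - 1)"
      using real_scaled_unit cD(1) \<mu>(1) by blast
    then show "inner (normal_vec e (P i)) (normal_vec e (P i)) = ell_joachimsthal h g k"
      using chain_not_opposite[OF ch] by blast
  qed
  moreover have "tangent_line c (side_line P i)" for i
    unfolding PD(3) tangent_line_def using touches_ell_line[OF f cD(1)] by blast
  ultimately show ?thesis
    using fD by (auto simp: elliptic_billiard_def caustic_def)
qed

lemma hyperbolic_billiardI:
  assumes f: "hyp_family h g k e c" and ch: "chain h g k q s" and P: "hyp_rep e h g q s P"
  shows "hyperbolic_billiard e c P"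
proof -
  note fD = hyp_familyD[OF f] and cD = chainD[OF ch] and PD = hyp_repD[OF ch P]
  have on: "P i \<in> points e" for i
    unfolding PD(1) hyp_line_on[OF f eps_cases] using cD(4) .
  have ne: "P i \<noteq> P (i + 1)" for i
    unfolding PD(1)[of i] PD(2)[of i] hyp_line_inj[OF f] using cD(7)[of i]
    by (metis eps_simps(4) mult_cancel_left)
  have J: "(quad e (P i) (P (i + 1)))\<^sup>2 = 4 * hyp_joachimsthal h g k * (dist (P i) (P (i + 1)))\<^sup>2" for i
    unfolding PD(1)[of i] PD(2)[of i]
    using quad_hyp_line_square[OF f eps_cases cD(1) cD(4) cD(5) cD(7)] .
  have diff: "P (i + 1) - P i = (s (i + 1) + s i) *\<^sub>R hyp_dir e h g (eps i) (q i)" for i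
    unfolding PD(1)[of i] PD(2)[of i]
    using hyp_line_affine[of e h g "eps i" "q i" "- s i"]
      hyp_line_affine[of e h g "eps i" "q i" "s (i + 1)"]
    by (simp add: algebra_simps)
  have "billiard e P"
  proof (rule billiardI[OF fD(6), where P = P and J = "hyp_joachimsthal h g k"])
    fix i
    show "P i \<in> points e" "P i \<noteq> P (i + 1)"
      "(quad e (P i) (P (i + 1)))\<^sup>2 = 4 * hyp_joachimsthal h g k * (dist (P i) (P (i + 1)))\<^sup>2"
      by (rule on, rule ne, rule J)
  next
    fix i
    assume a: "sgn (P (i + 1) - P i) = - sgn (P i - P (i - 1))"
    obtain \<mu> where \<mu>: "\<mu> > 0"
      "hyp_dir e h g (eps i) (q i) = (- \<mu>) *\<^sub>R hyp_dir e h g (eps (i - 1)) (q (i - 1))"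
      using sgn_opposite[OF a[unfolded diff diff[of "i - 1", simplified]]]
        chain_add_same_sign[OF ch] dir_nonzero(2)[OF fD(2,4) eps_cases]
      by (metis eps_simps(2))
    \<comment> \<open>The ordinates force \<open>\<mu> = 1\<close>, because \<open>eps\<close>
      alternates; the abscissae then lead to \<open>q i = cnj (q (i - 1))\<close>. The joint is its
      own conjugate, hence real, and the vertex is a point of contact.\<close>
    have "pt e (- h * Im (q i)) (eps i * g) =
        pt e (- \<mu> * (- h * Im (q (i - 1)))) (- \<mu> * (eps (i - 1) * g))"
      using arg_cong[OF \<mu>(2), of "\<lambda>z. centre e + z"]
      by (simp add: hyp_dir_def pt_def algebra_simps)
    then have "\<mu> = 1" and "- h * Im (q i) = - \<mu> * (- h * Im (q (i - 1)))"
      using fD(2) unfolding pt_eq_iff[OF fD(4)] by auto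
    then have "h * Im (q i) = h * (- Im (q (i - 1)))"
      by simp
    then have im: "Im (q i) = - Im (q (i - 1))"
      using fD(1) by (metis less_irrefl mult_cancel_left)
    have "(Re (q i))\<^sup>2 = (Re (q (i - 1)))\<^sup>2"
      using cD(1)[of i] cD(1)[of "i - 1"] im unfolding norm_1_cmod by simp
    moreover have "Re (q i) \<noteq> - Re (q (i - 1))"
      using chain_not_opposite[OF ch, of i] im by (auto simp: complex_eq_iff)
    ultimately have re: "Re (q i) = Re (q (i - 1))"
      by (simp add: power2_eq_iff)
    have "Im (q (i - 1) * Complex 1 (s i)) = Im (q i * Complex 1 (- s i))"
      using cD(3)[of "i - 1"] by simp
    then have "Im (q (i - 1)) + Re (q (i - 1)) * s i = Im (q i) - Re (q i) * s i"
      by (simp add: algebra_simps)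
    then have "Im (q i) - Re (q i) * s i = 0"
      unfolding im re by linarith
    then have "Im (q i * Complex 1 (- s i)) = 0"
      by (simp add: algebra_simps)
    then show "inner (normal_vec e (P i)) (normal_vec e (P i)) = hyp_joachimsthal h g k"
      unfolding PD(1) hyp_normal_square[OF f eps_cases cD(1) cD(4)] .
  qed
  moreover have "tangent_line c (side_line P i)" for i
    unfolding PD(3) using tangent_line_hyp_line[OF f eps_cases cD(1)] .
  ultimately show ?thesis
    using fD by (auto simp: hyperbolic_billiard_def caustic_def)
qed

text \<open>The two tangents through a vertex have parameters equal up to sign. Equal signs would
  mean one tangent only, so that the billiard runs back, and this contradicts
  \<open>ell_normal_square\<close>.\<close>

lemma elliptic_billiardD:
  assumes f: "ell_family h g k e c" and b: "elliptic_billiard e c P"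
  obtains q s where "chain h g k q s" "ell_rep e h g q s P"
proof -
  note fD = ell_familyD[OF f]
  have bl: "billiard e P" and tl: "\<And>i. tangent_line c (side_line P i)"
    using b by (auto simp: elliptic_billiard_def caustic_def)
  have on: "\<And>i. P i \<in> points e" and ne: "\<And>i. P i \<noteq> P (i + 1)"
    using bl by (auto simp: billiard_def)
  have "\<exists>r x y. norm r = 1 \<and> P i = ell_line e h g r x \<and> P (i + 1) = ell_line e h g r y" for i
  proof -
    obtain r where "norm r = 1" "side_line P i = range (ell_line e h g r)"
      using tangent_line_ellipse[OF f tl] by blast
    moreover have "P i \<in> side_line P i" "P (i + 1) \<in> side_line P i"
      unfolding side_line_def by (simp_all add: hull_inc)
    ultimately show ?thesis
      by blast
  qed
  then obtain q t t' where q: "\<And>i. norm (q i) = 1"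
    and P: "\<And>i. P i = ell_line e h g (q i) (t i)"
    and P': "\<And>i. P (i + 1) = ell_line e h g (q i) (t' i)"
    by metis
  have v: "vertex_param h g k (q i) (t i)" "vertex_param h g k (q i) (t' i)" for i
    using on[of i] on[of "i + 1"] ell_line_on[OF f q] P P' by metis+
  have tt': "t i \<noteq> t' i" for i
    using ne P P' by metis
  have neg: "t i * t' i < 0" for i
    using vertex_params(1)[OF fD(1-3) q v tt'] .
  have j: "q (i - 1) * Complex 1 (t' (i - 1)) = q i * Complex 1 (t i)" for i
    using P[of i] P'[of "i - 1"] ell_line_inj[OF f] by simp
  have sq: "(t' (i - 1))\<^sup>2 = (t i)\<^sup>2" for i
    using unit_tangent_square[OF q, of "i - 1" "t' (i - 1)"] unit_tangent_square[OF q, of i "t i"]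
    unfolding j by simp
  have t': "t' (i - 1) = - t i" for i
  proof (rule ccontr)
    assume "t' (i - 1) \<noteq> - t i"
    then have eq: "t' (i - 1) = t i"
      using sq[of i] by (simp add: power2_eq_iff)
    moreover have "Complex 1 (t i) \<noteq> 0"
      by (simp add: complex_eq_iff)
    ultimately have qq: "q (i - 1) = q i"
      using j[of i] by simp
    have "t (i - 1) = t' i"
      by (rule vertex_param_third[OF fD(2,3) v(1)[of i]])
        (use v(1)[of "i - 1"] v(2)[of i] tt'[of i] tt'[of "i - 1"] qq eq in auto)
    then have "P (i + 1) = P (i - 1)"
      using P[of "i - 1"] P'[of i] qq by simp
    moreover have "(quad e (P (i - 1)) (P i))\<^sup>2 =
        4 * ell_joachimsthal h g k * (dist (P (i - 1)) (P i))\<^sup>2"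
      using quad_ell_line_square[OF f q v(1) v(2) tt', of "i - 1"] P[of "i - 1"] P'[of "i - 1"] by simp
    ultimately have "inner (normal_vec e (P i)) (normal_vec e (P i)) = ell_joachimsthal h g k"
      using billiard_back[OF bl] by blast
    then show False
      using ell_normal_square[OF f on] by (metis less_irrefl)
  qed
  define s where "s = (\<lambda>i. - t i)"
  have "0 < s i * s (i + 1)" for i
    using neg[of i] t'[of "i + 1"] by (simp add: s_def)
  then have "chain h g k q s"
    using j v q unfolding chain_def by (simp add: s_def t')
  moreover have "ell_rep e h g q s P"
    unfolding ell_rep_def s_def using P by simp
  ultimately show ?thesis
    using that by blast
qed

lemma vertex_param_cnj: "vertex_param h g k (cnj q) t \<longleftrightarrow> vertex_param h g k q (- t)"
  by (simp add: vertex_param_def)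

text \<open>With alternating \<open>eps\<close> the ordinates yield
  \<open>t' (i - 1) = - t i\<close> at once; the joint is then known up to conjugation. The wrong
  choice gives \<open>q (i - 1) = cnj (q i)\<close>, which is the same side line run back. Such a
  reversal forces the joint to be real, and for a real joint the two choices agree.\<close>

lemma hyperbolic_billiardD:
  assumes f: "hyp_family h g k e c" and b: "hyperbolic_billiard e c P"
  obtains q s where "chain h g k q s" "hyp_rep e h g q s P"
proof -
  note fD = hyp_familyD[OF f]
  have bl: "billiard e P" and tl: "\<And>i. tangent_line c (side_line P i)"
    using b by (auto simp: hyperbolic_billiard_def caustic_def)
  have on: "\<And>i. P i \<in> points e" and ne: "\<And>i. P i \<noteq> P (i + 1)"
    using bl by (auto simp: billiard_def)
  have "\<exists>r x y. norm r = 1 \<and> P i = hyp_line e h g (eps i) r x \<and> P (i + 1) = hyp_line e h g (eps i) r y" for i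
  proof -
    obtain r where "norm r = 1" "side_line P i = range (hyp_line e h g (eps i) r)"
      using tangent_line_hyperbola[OF f eps_cases tl] by blast
    moreover have "P i \<in> side_line P i" "P (i + 1) \<in> side_line P i"
      unfolding side_line_def by (simp_all add: hull_inc)
    ultimately show ?thesis
      by blast
  qed
  then obtain q t t' where q: "\<And>i. norm (q i) = 1"
    and P: "\<And>i. P i = hyp_line e h g (eps i) (q i) (t i)"
    and P': "\<And>i. P (i + 1) = hyp_line e h g (eps i) (q i) (t' i)"
    by metis
  have v: "vertex_param h g k (q i) (t i)" "vertex_param h g k (q i) (t' i)" for i
    using on[of i] on[of "i + 1"] hyp_line_on[OF f eps_cases] P P' by metis+
  have tt': "t i \<noteq> t' i" for i
    using ne P P' by metis
  have neg: "t i * t' i < 0" for i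
    using vertex_params(1)[OF fD(1-3) q v tt'] .
  have jj: "Re (q (i - 1) * Complex 1 (t' (i - 1))) = Re (q i * Complex 1 (t i)) \<and>
      eps (i - 1) * t' (i - 1) = eps i * t i" for i
    using P[of i] P'[of "i - 1"] hyp_line_inj[OF f] by (metis diff_add_cancel)
  then have t': "t' (i - 1) = - t i" for i
    by (metis eps_simps(2,4) minus_minus mult_cancel_left mult_minus_left mult_minus_right)
  have j: "q (i - 1) * Complex 1 (- t i) = q i * Complex 1 (t i)" for i
  proof (rule ccontr)
    assume c: "q (i - 1) * Complex 1 (- t i) \<noteq> q i * Complex 1 (t i)"
    have re: "Re (q (i - 1) * Complex 1 (- t i)) = Re (q i * Complex 1 (t i))"
      using jj[of i] t' by simp
    have "(Im (q (i - 1) * Complex 1 (- t i)))\<^sup>2 = (Im (q i * Complex 1 (t i)))\<^sup>2"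
      using unit_tangent_square[OF q, of "i - 1" "- t i"] unit_tangent_square[OF q, of i "t i"]
      unfolding re by simp
    then have im: "Im (q (i - 1) * Complex 1 (- t i)) = - Im (q i * Complex 1 (t i))"
      using c re unfolding power2_eq_iff complex_eq_iff by blast
    then have im0: "Im (q i * Complex 1 (t i)) \<noteq> 0"
      using c re unfolding complex_eq_iff by (metis add.inverse_neutral)
    have "q (i - 1) * Complex 1 (- t i) = cnj (q i * Complex 1 (t i))"
      using re im by (simp only: complex_eq_iff) simp
    also have "\<dots> = cnj (q i) * Complex 1 (- t i)"
      by (simp add: complex_eq_iff)
    finally have "q (i - 1) * Complex 1 (- t i) = cnj (q i) * Complex 1 (- t i)" .
    moreover have "Complex 1 (- t i) \<noteq> 0"
      by (simp add: complex_eq_iff)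
    ultimately have qq: "q (i - 1) = cnj (q i)"
      by simp
    have "t' i = - t (i - 1)"
      by (rule vertex_param_third[OF fD(2,3) v(1)[of i]])
        (use v(1)[of "i - 1"] v(2)[of i] tt'[of i] tt'[of "i - 1"] qq t'[of i] vertex_param_cnj in auto)
    then have "P (i + 1) = P (i - 1)"
      using P[of "i - 1"] P'[of i] qq by (simp add: hyp_line_def)
    moreover have "(quad e (P (i - 1)) (P i))\<^sup>2 =
        4 * hyp_joachimsthal h g k * (dist (P (i - 1)) (P i))\<^sup>2"
      using quad_hyp_line_square[OF f eps_cases q v(1) v(2) tt', of "i - 1" "i - 1"]
        P[of "i - 1"] P'[of "i - 1"] by simp
    ultimately have "inner (normal_vec e (P i)) (normal_vec e (P i)) = hyp_joachimsthal h g k"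
      using billiard_back[OF bl] by blast
    then show False
      using im0 hyp_normal_square[OF f eps_cases q v(1), of i] P by metis
  qed
  define s where "s = (\<lambda>i. - t i)"
  have "0 < s i * s (i + 1)" for i
    using neg[of i] t'[of "i + 1"] by (simp add: s_def)
  then have "chain h g k q s"
    using j v q unfolding chain_def by (simp add: s_def t')
  moreover have "hyp_rep e h g q s P"
    unfolding hyp_rep_def s_def using P by simp
  ultimately show ?thesis
    using that by blast
qed

text \<open>What needs proof is \<open>0 < k\<close>, that the caustic is the smaller ellipse. A
  tangent of a confocal ellipse containing \<open>e\<close> could meet \<open>e\<close> at its
  contact point only, but a side line contains two vertices.\<close>

lemma elliptic_billiard_family:
  assumes b: "elliptic_billiard e c P"
  obtains h g k where "ell_family h g k e c"
proof -
  have bl: "billiard e P" and e: "is_ellipse e" and c: "is_ellipse c" and cf: "confocal e c"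
    and tl: "tangent_line c (side_line P 0)"
    using b by (auto simp: elliptic_billiard_def caustic_def billiard_def)
  have on: "\<And>i. P i \<in> points e" and ne: "\<And>i. P i \<noteq> P (i + 1)"
    using bl by (auto simp: billiard_def)
  have u: "norm (axis_dir e) = 1" "norm (axis_dir c) = 1" "sqB e < sqA e" "sqB c < sqA c"
    "0 < sqB e" "0 < sqB c"
    using e c by (auto simp: is_ellipse_def)
  have al: "aligned e c" and d: "sqA c - sqB c = sqA e - sqB e"
    using cf u unfolding confocal_iff[OF u(1,3,2,4)] by (auto simp: aligned_def)
  have "sqA c < sqA e"
  proof (rule ccontr)
    assume "\<not> sqA c < sqA e"
    then have le: "sqA e \<le> sqA c" "sqB e \<le> sqB c"
      using d by auto
    have "asymptotes c = {}"
      using u by (simp add: asymptotes_def is_hyperbola_def)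
    then obtain T where T: "T \<in> points c" "side_line P 0 = tangent_at c T"
      using tl by (auto simp: tangent_line_def touches_def)
    have "X = T" if X: "X \<in> points e" "X \<in> tangent_at c T" for X
    proof -
      define x y x' y' where "x = xc e X" and "y = yc e X" and "x' = xc e T" and "y' = yc e T"
      have XT: "X = pt e x y" "T = pt e x' y'"
        using pt_coords[OF u(1)] by (simp_all add: x_def y_def x'_def y'_def)
      have 1: "x'\<^sup>2 / sqA c + y'\<^sup>2 / sqB c = 1" "x' * x / sqA c + y' * y / sqB c = 1"
        using T(1) X(2) unfolding XT aligned_points[OF al] aligned_tangent_at[OF al] .
      have "x\<^sup>2 / sqA c + y\<^sup>2 / sqB c \<le> x\<^sup>2 / sqA e + y\<^sup>2 / sqB e"
        using le u by (intro add_mono divide_left_mono) auto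
      also have "\<dots> = 1"
        using X(1) by (simp add: points_def x_def y_def)
      finally have 2: "x\<^sup>2 / sqA c + y\<^sup>2 / sqB c \<le> 1" .
      \<comment> \<open>\<open>T\<close> and \<open>X\<close> both satisfy the tangent equation of
        \<open>T\<close>, so the form at \<open>X - T\<close> is at most 1 - 2 + 1.\<close>
      have "(x - x')\<^sup>2 / sqA c + (y - y')\<^sup>2 / sqB c =
          (x\<^sup>2 / sqA c + y\<^sup>2 / sqB c) - 2 * (x' * x / sqA c + y' * y / sqB c) + (x'\<^sup>2 / sqA c + y'\<^sup>2 / sqB c)"
        by (simp add: power2_eq_square algebra_simps add_divide_distrib diff_divide_distrib)
      then have "(x - x')\<^sup>2 / sqA c + (y - y')\<^sup>2 / sqB c \<le> 0"
        using 2 unfolding 1 by simp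
      moreover have "(x - x')\<^sup>2 / sqA c \<ge> 0" "(y - y')\<^sup>2 / sqB c \<ge> 0"
        using u by simp_all
      ultimately have "(x - x')\<^sup>2 / sqA c = 0" "(y - y')\<^sup>2 / sqB c = 0"
        by linarith+
      then show ?thesis
        using u unfolding XT by auto
    qed
    moreover have "P 0 \<in> side_line P 0" "P 1 \<in> side_line P 0"
      unfolding side_line_def by (simp_all add: hull_inc)
    ultimately show False
      using on T(2) ne[of 0] by (metis add_0)
  qed
  then have "ell_family (sqrt (sqA c - sqB c)) (sqrt (sqB c)) (sqA e - sqA c) e c"
    using al u d by (simp add: ell_family_def)
  then show ?thesis
    using that by blast
qed

lemma hyperbolic_billiard_family:
  assumes b: "hyperbolic_billiard e c P"
  obtains h g k where "hyp_family h g k e c"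
proof -
  have e: "is_ellipse e" and c: "is_hyperbola c" and cf: "confocal e c"
    using b by (auto simp: hyperbolic_billiard_def caustic_def billiard_def)
  have u: "norm (axis_dir e) = 1" "norm (axis_dir c) = 1" "sqB e < sqA e" "sqB c < sqA c"
    "0 < sqB e" "sqB c < 0" "0 < sqA c"
    using e c by (auto simp: is_ellipse_def is_hyperbola_def)
  have "aligned e c" "sqA c - sqB c = sqA e - sqB e"
    using cf u unfolding confocal_iff[OF u(1,3,2,4)] by (auto simp: aligned_def)
  then have "hyp_family (sqrt (sqA c)) (sqrt (- sqB c)) (sqB e) e c"
    using u by (simp add: hyp_family_def)
  then show ?thesis
    using that by blast
qed

subsection \<open>The isometric correspondence\<close>

lemma isometric_reps:
  assumes fe: "ell_family h g k e c" and fh: "hyp_family h g k e' c'" and ch: "chain h g k q s"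
    and P: "ell_rep e h g q s P" and P': "hyp_rep e' h g q s P'"
  shows "isometric_polygons P P'"
proof -
  have "(dist (P i) (P (i + 1)))\<^sup>2 = (dist (P' i) (P' (i + 1)))\<^sup>2" for i
    unfolding ell_repD(1,2)[OF ch P, of i] hyp_repD(1,2)[OF ch P', of i]
      dist_ell_line[OF ell_familyD(4)[OF fe] chainD(1)[OF ch]]
      dist_hyp_line[OF hyp_familyD(4)[OF fh] eps_cases] ..
  then show ?thesis
    unfolding isometric_polygons_def by (simp add: power2_eq_iff_nonneg)
qed

lemma side_isometry_reps:
  assumes fe: "ell_family h g k e c" and ch: "chain h g k q s"
    and P: "ell_rep e h g q s P" and P': "hyp_rep e' h g q s P'"
  shows "side_isometry P P' i (ell_line e h g (q i) t) = hyp_line e' h g (eps i) (q i) t"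
proof -
  have "side_isometry P P' i (ell_line e h g (q i) 0 + t *\<^sub>R ell_dir e h g (q i)) =
      hyp_line e' h g (eps i) (q i) 0 + t *\<^sub>R hyp_dir e' h g (eps i) (q i)"
  proof (rule side_isometry_param[where a = "- s i" and b = "s (i + 1)"])
    show "- s i \<noteq> s (i + 1)"
      using chainD(7)[OF ch] .
    show "ell_dir e h g (q i) \<noteq> 0"
      using dir_nonzero(1)[OF ell_familyD(2,4)[OF fe] chainD(1)[OF ch]] .
  qed (simp_all only: ell_line_affine[symmetric] hyp_line_affine[symmetric]
      ell_repD(1,2)[OF ch P, of i] hyp_repD(1,2)[OF ch P', of i])
  then show ?thesis
    by (simp only: ell_line_affine[symmetric] hyp_line_affine[symmetric])
qed

lemma Complex_1_nonzero: "Complex 1 t \<noteq> 0"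
  by (simp add: complex_eq_iff)

text \<open>Each tangent of the hyperbola is the flattened image of two generators, one from each
  family. Conjugating \<open>q\<close> switches between them and reverses the parameter.\<close>

lemma hyp_line_cnj: "range (hyp_line e h g \<epsilon> (cnj q)) = range (hyp_line e h g (- \<epsilon>) q)"
proof -
  have "hyp_line e h g \<epsilon> (cnj q) t = hyp_line e h g (- \<epsilon>) q (- t)" for t
    by (simp add: hyp_line_def)
  moreover have "surj (uminus :: real \<Rightarrow> real)"
    by simp
  ultimately show ?thesis
    by (metis (mono_tags, lifting) fun.set_map image_comp image_cong comp_apply)
qed

lemma ell_lines_meet:
  assumes f: "ell_family h g k e c" and q: "norm q = 1" "norm r = 1" and ne: "q \<noteq> r"
    and S: "S \<in> range (ell_line e h g q)" "S \<in> range (ell_line e h g r)"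
  obtains t where "S = ell_line e h g q t" "q * Complex 1 t = r * Complex 1 (- t)"
proof -
  obtain t t' where t: "S = ell_line e h g q t" and "S = ell_line e h g r t'"
    using S by blast
  then have e: "q * Complex 1 t = r * Complex 1 t'"
    using ell_line_inj[OF f] by simp
  then have "t\<^sup>2 = t'\<^sup>2"
    using unit_tangent_square[OF q(1), of t] unit_tangent_square[OF q(2), of t'] by simp
  moreover have "t \<noteq> t'"
    using e ne Complex_1_nonzero by auto
  ultimately have "t' = - t"
    by (auto simp: power2_eq_iff)
  then show ?thesis
    using that t e by blast
qed

text \<open>For opposite families the ordinates give opposite parameters, and the conjugate solution
  would make the lines equal. What remains is the relation that \<open>ell_lines_meet\<close>
  derives from equal tangent lengths.\<close>

lemma hyp_lines_meet:
  assumes f: "hyp_family h g k e c" and q: "norm q = 1" "norm r = 1" and \<epsilon>: "\<epsilon> \<in> {1, - 1}"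
    and ne: "range (hyp_line e h g \<epsilon> q) \<noteq> range (hyp_line e h g (- \<epsilon>) r)"
    and S: "S \<in> range (hyp_line e h g \<epsilon> q)" "S \<in> range (hyp_line e h g (- \<epsilon>) r)"
  obtains t where "S = hyp_line e h g \<epsilon> q t" "q * Complex 1 t = r * Complex 1 (- t)"
proof -
  obtain t t' where t: "S = hyp_line e h g \<epsilon> q t" and "S = hyp_line e h g (- \<epsilon>) r t'"
    using S by blast
  then have re: "Re (q * Complex 1 t) = Re (r * Complex 1 t')" and "\<epsilon> * t = - \<epsilon> * t'"
    using hyp_line_inj[OF f] by simp_all
  then have t': "t' = - t"
    using \<epsilon> by auto
  have "(Im (q * Complex 1 t))\<^sup>2 = (Im (r * Complex 1 (- t)))\<^sup>2"
    using unit_tangent_square[OF q(1), of t] unit_tangent_square[OF q(2), of "- t"] re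
    unfolding t' by simp
  moreover have "Im (q * Complex 1 t) \<noteq> - Im (r * Complex 1 (- t))"
  proof
    assume "Im (q * Complex 1 t) = - Im (r * Complex 1 (- t))"
    then have "q * Complex 1 t = cnj (r * Complex 1 (- t))"
      using re unfolding t' by (simp only: complex_eq_iff) simp
    also have "\<dots> = cnj r * Complex 1 t"
      by (simp add: complex_eq_iff)
    finally have "q = cnj r"
      using Complex_1_nonzero by simp
    then show False
      using ne hyp_line_cnj by blast
  qed
  ultimately have "q * Complex 1 t = r * Complex 1 (- t)"
    using re unfolding t' power2_eq_iff complex_eq_iff by blast
  then show ?thesis
    using that t by blast
qed

text \<open>Subtracting the equations for two different parameters gives \<open>r = - q\<close>, for
  which neither equation can hold. Hence grid points of both polygons on the same pair of lines
  carry the same \<open>t\<close>.\<close>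

lemma tangent_lengths_unique:
  assumes "q \<noteq> 0" "q * Complex 1 t = r * Complex 1 (- t)" "q * Complex 1 u = r * Complex 1 (- u)"
  shows "t = u"
proof (rule ccontr)
  assume ne: "t \<noteq> u"
  have c: "Complex 1 t - Complex 1 u = Complex 0 1 * complex_of_real (t - u)"
    "Complex 1 (- t) - Complex 1 (- u) = - (Complex 0 1 * complex_of_real (t - u))"
    by (simp_all add: complex_eq_iff)
  have "q * (Complex 1 t - Complex 1 u) = r * (Complex 1 (- t) - Complex 1 (- u))"
    using assms(2,3) by (simp only: right_diff_distrib)
  then have "(q + r) * (Complex 0 1 * complex_of_real (t - u)) = 0"
    unfolding c by (simp only: distrib_right mult_minus_right) simp
  moreover have "Complex 0 1 * complex_of_real (t - u) \<noteq> 0"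
    using ne by (simp add: complex_eq_iff)
  ultimately have r: "r = - q"
    by (metis add_eq_0_iff mult_eq_0_iff)
  have "q * (Complex 1 t + Complex 1 (- t)) = 0"
    using assms(2) unfolding r by (simp only: distrib_left) simp
  moreover have "Complex 1 t + Complex 1 (- t) \<noteq> 0"
    by (simp add: complex_eq_iff)
  ultimately show False
    using assms(1) by simp
qed

lemma eps_opposite: "odd (j - i) \<Longrightarrow> eps j = - eps i"
  by (auto simp: eps_def)

lemma grid_correspondence_reps:
  assumes fe: "ell_family h g k e c" and fh: "hyp_family h g k e' c'" and ch: "chain h g k q s"
    and P: "ell_rep e h g q s P" and P': "hyp_rep e' h g q s P'"
  shows "grid_correspondence P P'"
proof -
  note PD = ell_repD[OF ch P] and PD' = hyp_repD[OF ch P'] and cD = chainD[OF ch]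
  \<comment> \<open>The indices differ by 2m + 1; this oddness is where even j enters.\<close>
  have op: "eps (n + int m) = - eps (n - int m - 1)" for n m
    by (rule eps_opposite) simp
  have grid: "\<exists>t. S = ell_line e h g (q (n - int m - 1)) t \<and> S = ell_line e h g (q (n + int m)) (- t) \<and>
      q (n - int m - 1) * Complex 1 t = q (n + int m) * Complex 1 (- t)"
    if S: "grid_point P n m S" for n m S
  proof -
    have "q (n - int m - 1) \<noteq> q (n + int m)"
      using S by (auto simp: grid_point_def PD(3))
    then obtain t where "S = ell_line e h g (q (n - int m - 1)) t"
      "q (n - int m - 1) * Complex 1 t = q (n + int m) * Complex 1 (- t)"
      using ell_lines_meet[OF fe cD(1) cD(1), of "n - int m - 1" "n + int m" S] S
      unfolding grid_point_def PD(3) by (metis Int_iff)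
    then show ?thesis
      using ell_line_inj[OF fe] by blast
  qed
  have grid': "\<exists>t. S = hyp_line e' h g (eps (n - int m - 1)) (q (n - int m - 1)) t \<and>
      q (n - int m - 1) * Complex 1 t = q (n + int m) * Complex 1 (- t)"
    if "grid_point P' n m S" for n m S
  proof -
    let ?L = "range (hyp_line e' h g (eps (n - int m - 1)) (q (n - int m - 1)))"
    let ?M = "range (hyp_line e' h g (- eps (n - int m - 1)) (q (n + int m)))"
    have "?L \<noteq> ?M" "S \<in> ?L" "S \<in> ?M"
      using that unfolding grid_point_def PD'(3) op by simp_all
    from hyp_lines_meet[OF fh cD(1) cD(1) eps_cases this] show ?thesis
      by metis
  qed
  show ?thesis
    unfolding grid_correspondence_def
  proof (intro conjI allI impI ballI)
    fix n m S i
    assume a: "grid_point P n m S \<and> side_line P' (n - int m - 1) \<noteq> side_line P' (n + int m)"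
      and i: "i \<in> {n - int m - 1, n + int m}"
    obtain t where t: "S = ell_line e h g (q (n - int m - 1)) t" "S = ell_line e h g (q (n + int m)) (- t)"
      "q (n - int m - 1) * Complex 1 t = q (n + int m) * Complex 1 (- t)"
      using grid a by blast
    have "side_isometry P P' (n - int m - 1) S =
        hyp_line e' h g (eps (n - int m - 1)) (q (n - int m - 1)) t"
      unfolding t(1) by (rule side_isometry_reps[OF fe ch P P'])
    moreover have "side_isometry P P' (n + int m) S = hyp_line e' h g (eps (n + int m)) (q (n + int m)) (- t)"
      unfolding t(2) by (rule side_isometry_reps[OF fe ch P P'])
    moreover have "hyp_line e' h g (eps (n - int m - 1)) (q (n - int m - 1)) t =
        hyp_line e' h g (eps (n + int m)) (q (n + int m)) (- t)"
      unfolding hyp_line_inj[OF fh] using t(3) op by simp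
    ultimately have "side_isometry P P' i S = hyp_line e' h g (eps (n - int m - 1)) (q (n - int m - 1)) t"
      "side_isometry P P' i S = hyp_line e' h g (eps (n + int m)) (q (n + int m)) (- t)"
      using i by (metis insertE singletonD)+
    then have "side_isometry P P' i S \<in> side_line P' (n - int m - 1) \<inter> side_line P' (n + int m)"
      unfolding PD'(3) by (metis IntI rangeI)
    then show "grid_point P' n m (side_isometry P P' i S)"
      using a unfolding grid_point_def by blast
  next
    fix n m S'
    assume a: "grid_point P' n m S' \<and> side_line P (n - int m - 1) \<noteq> side_line P (n + int m)"
    then obtain t where t: "q (n - int m - 1) * Complex 1 t = q (n + int m) * Complex 1 (- t)"
      using grid' by blast
    then have "ell_line e h g (q (n - int m - 1)) t = ell_line e h g (q (n + int m)) (- t)"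
      using ell_line_inj[OF fe] by blast
    then show "\<exists>S. grid_point P n m S"
      using a unfolding grid_point_def PD(3) by (metis IntI rangeI)
  next
    fix i n m S S'
    assume a: "n = i + int m \<and> grid_point P n m S \<and> grid_point P' n m S'"
    \<comment> \<open>For k = i + m the first of the two lines is the side ending in
      \<open>P i\<close>, where the vertex has parameter \<open>s i\<close>.\<close>
    then have n: "n - int m - 1 = i - 1"
      by simp
    obtain t where t: "S = ell_line e h g (q (i - 1)) t"
      "q (i - 1) * Complex 1 t = q (n + int m) * Complex 1 (- t)"
      using grid a unfolding n[symmetric] by blast
    obtain t' where t': "S' = hyp_line e' h g (eps (i - 1)) (q (i - 1)) t'"
      "q (i - 1) * Complex 1 t' = q (n + int m) * Complex 1 (- t')"
      using grid' a unfolding n[symmetric] by blast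
    have tt: "t' = t"
      using tangent_lengths_unique[OF cD(8) t'(2) t(2)] .
    have "P i = ell_line e h g (q (i - 1)) (s i)" "P' i = hyp_line e' h g (eps (i - 1)) (q (i - 1)) (s i)"
      using PD(2)[of "i - 1"] PD'(2)[of "i - 1"] by simp_all
    then have "(dist (P' i) S')\<^sup>2 = (dist (P i) S)\<^sup>2"
      using t(1) t'(1) unfolding tt
      by (simp only: dist_ell_line[OF ell_familyD(4)[OF fe] cD(1)]
        dist_hyp_line[OF hyp_familyD(4)[OF fh] eps_cases])
    then show "dist (P' i) S' = dist (P i) S"
      by (simp add: power2_eq_iff_nonneg)
  qed
qed

text \<open>The equations \<open>t = 0\<close> and \<open>Im (q i * Complex 1 t) = 0\<close>
  exchange their meaning: contact and axis point for the ellipse, axis point and contact for the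
  hyperbola. The isometry keeps \<open>t\<close>.\<close>

lemma contact_correspondence_reps:
  assumes fe: "ell_family h g k e c" and fh: "hyp_family h g k e' c'" and ch: "chain h g k q s"
    and P: "ell_rep e h g q s P" and P': "hyp_rep e' h g q s P'"
  shows "contact_correspondence e c P e' c' P'"
proof -
  note PD = ell_repD[OF ch P] and PD' = hyp_repD[OF ch P'] and cD = chainD[OF ch]
  have ax': "hyp_line e' h g (eps i) (q i) t \<in> principal_axis e' \<longleftrightarrow> t = 0" for i t
    unfolding hyp_line_def pt_in_principal_axis[OF hyp_familyD(4,9)[OF fh]]
    using hyp_familyD(2)[OF fh] by simp
  have ax: "ell_line e h g (q i) t \<in> principal_axis e \<longleftrightarrow> Im (q i * Complex 1 t) = 0" for i t
    unfolding ell_line_def pt_in_principal_axis[OF ell_familyD(4,9)[OF fe]]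
    using ell_familyD(2)[OF fe] by simp
  have seg: "closed_segment (P' i) (P' (i + 1)) \<inter> principal_axis e' =
      {hyp_line e' h g (eps i) (q i) 0}" for i
  proof -
    define F where "F = hyp_line e' h g (eps i) (q i)"
    have comb: "(1 - u) *\<^sub>R P' i + u *\<^sub>R P' (i + 1) = F ((1 - u) * (- s i) + u * s (i + 1))" for u
      unfolding PD'(1)[of i] PD'(2)[of i] F_def
        hyp_line_affine[of e' h g "eps i" "q i" "- s i"]
        hyp_line_affine[of e' h g "eps i" "q i" "s (i + 1)"]
        hyp_line_affine[of e' h g "eps i" "q i" "(1 - u) * (- s i) + u * s (i + 1)"]
      by (simp add: algebra_simps)
    \<comment> \<open>The weight that produces the parameter 0; it lies between 0 and 1 because
      \<open>s i\<close> and \<open>s (i + 1)\<close> have equal signs.\<close>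
    define u where "u = s i / (s i + s (i + 1))"
    have ss: "s i + s (i + 1) \<noteq> 0" and pos: "0 < s i * s (i + 1)"
      using cD(7)[of i] cD(2)[of i] by auto
    have "u * (s i + s (i + 1)) = s i"
      using ss by (simp add: u_def)
    then have "(1 - u) * (- s i) + u * s (i + 1) = 0"
      by (simp add: algebra_simps)
    then have "F 0 = (1 - u) *\<^sub>R P' i + u *\<^sub>R P' (i + 1)"
      unfolding comb by simp
    moreover have "0 \<le> u" "u \<le> 1"
      using pos by (auto simp: u_def zero_less_mult_iff divide_simps)
    ultimately have "F 0 \<in> closed_segment (P' i) (P' (i + 1))"
      unfolding closed_segment_def by blast
    moreover have "X = F 0" if "X \<in> closed_segment (P' i) (P' (i + 1))" "X \<in> principal_axis e'" for X
      using that ax' unfolding closed_segment_def comb F_def by auto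
    ultimately show ?thesis
      using ax' unfolding F_def by blast
  qed
  show ?thesis
    unfolding contact_correspondence_def
  proof (intro allI conjI impI ballI)
    fix i Q
    assume "touches c (side_line P i) Q"
    then have "Q = ell_line e h g (q i) 0"
      unfolding PD(3) touches_ell_line[OF fe cD(1)] .
    then show "closed_segment (P' i) (P' (i + 1)) \<inter> principal_axis e' = {side_isometry P P' i Q}"
      using seg side_isometry_reps[OF fe ch P P'] by simp
  next
    fix i T
    assume "T \<in> side_line P i"
    then obtain t where T: "T = ell_line e h g (q i) t"
      unfolding PD(3) by blast
    show "T \<in> principal_axis e \<longleftrightarrow> touches c' (side_line P' i) (side_isometry P P' i T)"
      unfolding T ax side_isometry_reps[OF fe ch P P'] PD'(3) touches_hyp_line[OF fh eps_cases cD(1)] ..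
  qed
qed

subsection \<open>Uniqueness\<close>

text \<open>A line has two vertex parameters of opposite sign, and the orientation tells which one
  comes next; the joint then yields the next line. So one line and an orientation determine the
  chain in both directions.\<close>

lemma chain_cong:
  assumes c: "chain h g k q s" and d: "chain h g k r u" and eq: "q j = r j" and sg: "0 < s j * u j"
    and gk: "0 < g" "0 < k"
  shows "q = r" "s = u"
proof -
  note cD = chainD[OF c] and dD = chainD[OF d]
  have sg': "0 < s m * u n" for m n
    using chain_same_sign[OF c, of j m] chain_same_sign[OF d, of j n] sg
    by (auto simp: zero_less_mult_iff)
  then have ne: "- s m \<noteq> u n" for m n
    by (metis mult_minus_left neg_less_0_iff_less not_less_iff_gr_or_eq not_square_less_zero
        verit_minus_simplify(4))
  have step: "s (i + 1) = u (i + 1) \<and> s i = u i \<and> q (i + 1) = r (i + 1) \<and> q (i - 1) = r (i - 1)"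
    if "q i = r i" for i
  proof -
    have 1: "s (i + 1) = u (i + 1)"
      by (rule vertex_param_third[OF gk cD(4)[of i] cD(5)[of i]])
        (use dD(5)[of i] that cD(7)[of i] ne in auto)
    have "- s i = - u i"
      by (rule vertex_param_third[OF gk cD(5)[of i] cD(4)[of i]])
        (use dD(4)[of i] that cD(7)[of i] dD(7)[of i] 1 in auto)
    then have 2: "s i = u i"
      by simp
    have "q (i + 1) = r (i + 1)"
      using cD(3)[of i] dD(3)[of i] that 1 Complex_1_nonzero by simp
    moreover have "q (i - 1) = r (i - 1)"
      using cD(3)[of "i - 1"] dD(3)[of "i - 1"] that 2 Complex_1_nonzero
      by (metis diff_add_cancel mult_right_cancel)
    ultimately show ?thesis
      using 1 2 by blast
  qed
  have q: "q i = r i" for i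
    by (induction i rule: int_induct[where k = j]) (use eq step in auto)
  then show "q = r" "s = u"
    using step by auto
qed

text \<open>In the hyperbolic picture this symmetry negates the abscissae of the vertices and keeps
  the ordinates, while \<open>chain_cnj\<close> below does the converse.\<close>

lemma chain_uminus: "chain h g k q s \<Longrightarrow> chain h g k (\<lambda>i. - q i) s"
  by (simp add: chain_def vertex_param_def power2_eq_square algebra_simps)

lemma chain_cnj:
  assumes "chain h g k q s"
  shows "chain h g k (\<lambda>i. cnj (q i)) (\<lambda>i. - s i)"
proof -
  have "cnj (q (i - 1)) * Complex 1 (- s i) = cnj (q i) * Complex 1 (s i)" for i
    using arg_cong[OF chainD(3)[OF assms, of "i - 1"], of cnj] by (simp add: complex_eq_iff)
  then show ?thesis
    using assms by (simp add: chain_def vertex_param_cnj)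
qed

lemma chain_shift:
  assumes "chain h g k q s"
  shows "chain h g k (\<lambda>i. q (i + m)) (\<lambda>i. s (i + m))"
  unfolding chain_def
proof (intro allI conjI)
  fix i
  show "norm (q (i + m)) = 1" "vertex_param h g k (q (i + m)) (- s (i + m))"
    using chainD[OF assms] by auto
  show "0 < s (i + m) * s (i + 1 + m)"
    using chain_same_sign[OF assms] .
  show "q (i - 1 + m) * Complex 1 (s (i + m)) = q (i + m) * Complex 1 (- s (i + m))"
    using chainD(3)[OF assms, of "i - 1 + m"] by simp
qed

text \<open>Reversal alone would change the sign of \<open>s\<close>; conjugation restores it, so
  the orientation agrees with that of the original. Sides are renumbered by \<open>- i\<close>,
  hence vertices by \<open>1 - i\<close>.\<close>

lemma chain_reverse:
  assumes "chain h g k q s"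
  shows "chain h g k (\<lambda>i. cnj (q (- i))) (\<lambda>i. s (1 - i))"
  unfolding chain_def
proof (intro allI conjI)
  fix i
  show "norm (cnj (q (- i))) = 1"
    using chainD(1)[OF assms] by simp
  show "vertex_param h g k (cnj (q (- i))) (- s (1 - i))"
    using chainD(5)[OF assms, of "- i"] by (simp add: vertex_param_cnj)
  show "0 < s (1 - i) * s (1 - (i + 1))"
    using chain_same_sign[OF assms] .
  show "cnj (q (- (i - 1))) * Complex 1 (s (1 - i)) = cnj (q (- i)) * Complex 1 (- s (1 - i))"
    using arg_cong[OF chainD(3)[OF assms, of "- i"], of cnj] by (simp add: complex_eq_iff)
qed

lemma unit_Im_square:
  assumes "norm (q :: complex) = 1" "norm r = 1" "(Im q)\<^sup>2 = (Im r)\<^sup>2"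
  shows "r = q \<or> r = - q \<or> r = cnj q \<or> r = - cnj q"
proof -
  have "(Re q)\<^sup>2 = (Re r)\<^sup>2"
    using assms unfolding norm_1_cmod by simp
  then show ?thesis
    using assms(3) by (auto simp: complex_eq_iff power2_eq_iff)
qed

text \<open>The discriminant formula writes the squared side length as \<open>K\<close> times the
  square of \<open>dir_square / line_quad\<close>, a positive quotient of two affine functions of
  the squared ordinate.\<close>

lemma chain_lengths:
  assumes pos: "0 < h" "0 < g" "0 < k" and c: "chain h g k q s" and d: "chain h g k r u"
    and len: "(s i + s (i + 1))\<^sup>2 * dir_square h g (q i) = (u i + u (i + 1))\<^sup>2 * dir_square h g (r i)"
  shows "(Im (q i))\<^sup>2 = (Im (r i))\<^sup>2"
proof -
  define a2 where "a2 = h\<^sup>2 + g\<^sup>2 + k"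
  have a2: "a2 > k"
    using pos by (simp add: a2_def add_pos_pos)
  define K where "K = 4 * ((g\<^sup>2 + k) / (a2 * k))"
  have K: "K > 0"
    using a2 pos by (simp add: K_def add_pos_pos)
  have sq: "(s i + s (i + 1))\<^sup>2 * dir_square h g (q i) = K * (dir_square h g (q i) / line_quad h g k (q i))\<^sup>2"
    if ch: "chain h g k q s" for q s
  proof -
    have "(- s i - s (i + 1))\<^sup>2 * (line_quad h g k (q i))\<^sup>2 = K * dir_square h g (q i)"
      using vertex_params(2)[OF pos chainD(1,4,5,7)[OF ch]] by (simp add: K_def a2_def)
    moreover have "(- s i - s (i + 1))\<^sup>2 = (s i + s (i + 1))\<^sup>2"
      by (simp add: power2_eq_square algebra_simps)
    ultimately have "(s i + s (i + 1))\<^sup>2 = K * dir_square h g (q i) / (line_quad h g k (q i))\<^sup>2"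
      using line_quad_pos[OF pos(2,3), of h "q i"] by (simp add: field_simps)
    then show ?thesis
      by (simp add: power2_eq_square)
  qed
  have "(dir_square h g (q i) / line_quad h g k (q i))\<^sup>2 = (dir_square h g (r i) / line_quad h g k (r i))\<^sup>2"
    using len K unfolding sq[OF c] sq[OF d] by simp
  moreover have p: "dir_square h g z > 0" "line_quad h g k z > 0" for z
    using line_quad_pos dir_square_pos pos by auto
  ultimately have "dir_square h g (q i) / line_quad h g k (q i) = dir_square h g (r i) / line_quad h g k (r i)"
    by (simp add: power2_eq_iff_nonneg less_imp_le)
  then have "dir_square h g (q i) * line_quad h g k (r i) = dir_square h g (r i) * line_quad h g k (q i)"
    using p(2)[of "q i"] p(2)[of "r i"] by (simp add: field_simps)
  \<comment> \<open>Here \<open>1 / k - 1 / a2\<close> comes from the determinant of that linear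
    fractional function; as it is nonzero, the function is injective.\<close>
  then have "(h\<^sup>2 * g\<^sup>2) * ((Im (q i))\<^sup>2 - (Im (r i))\<^sup>2) * (1 / k - 1 / a2) = 0"
    unfolding dir_square_def line_quad_def a2_def[symmetric]
    by (simp add: algebra_simps diff_divide_distrib)
  moreover have "1 / k - 1 / a2 \<noteq> 0"
    using a2 pos by simp
  ultimately show ?thesis
    using pos by simp
qed

text \<open>
  Up to the symmetries of the ellipse, a billiard with the same side lengths and orientation either
  agrees with the given one at the line 0 or is its reversal there; in the second case the lines
  \<open>- 1\<close> and \<open>1\<close> are congruent as well, which leaves only the 4-periodic billiards.
\<close>

lemma chain_rigid_oriented:
  assumes pos: "0 < g" "0 < k" and c: "chain h g k q s" and d: "chain h g k r u"
    and im: "\<And>i. (Im (q i))\<^sup>2 = (Im (r i))\<^sup>2" and sg: "0 < s 0 * u 0"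
  shows "\<exists>\<sigma> \<in> {1, - 1 :: real}. (\<forall>i. r i = \<sigma> *\<^sub>R q i \<and> u i = s i) \<or>
    (\<forall>i. q (i + 2) = - q i \<and> s (i + 2) = s i) \<and> (\<forall>i. r i = \<sigma> *\<^sub>R cnj (q (- i)) \<and> u i = s (1 - i))"
proof -
  have "\<exists>\<sigma> \<in> {1, - 1 :: real}. \<sigma> *\<^sub>R r 0 = q 0 \<or> \<sigma> *\<^sub>R r 0 = cnj (q 0)"
    using unit_Im_square[OF chainD(1)[OF c] chainD(1)[OF d] im, of 0] by auto
  then obtain \<sigma> :: real where \<sigma>: "\<sigma> \<in> {1, - 1}" and r0: "\<sigma> *\<^sub>R r 0 = q 0 \<or> \<sigma> *\<^sub>R r 0 = cnj (q 0)"
    by blast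
  have \<sigma>\<sigma>: "z = \<sigma> *\<^sub>R w \<longleftrightarrow> \<sigma> *\<^sub>R z = w" for z w :: complex
    using \<sigma> by auto
  have d': "chain h g k (\<lambda>i. \<sigma> *\<^sub>R r i) u"
    using \<sigma> d chain_uminus[OF d] by auto
  from r0 show ?thesis
  proof
    assume "\<sigma> *\<^sub>R r 0 = q 0"
    then have "(\<lambda>i. \<sigma> *\<^sub>R r i) = q" "u = s"
      using chain_cong[OF d' c _ _ pos, of 0] sg by (simp_all add: mult.commute)
    then have "\<forall>i. r i = \<sigma> *\<^sub>R q i \<and> u i = s i"
      unfolding \<sigma>\<sigma> by metis
    then show ?thesis
      using \<sigma> by blast
  next
    assume r0: "\<sigma> *\<^sub>R r 0 = cnj (q 0)"
    have rv: "chain h g k (\<lambda>i. cnj (q (- i))) (\<lambda>i. s (1 - i))"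
      using chain_reverse[OF c] .
    have "0 < u 0 * s (1 - 0)"
      using sg chain_same_sign[OF c, of 0 1] by (auto simp: zero_less_mult_iff)
    then have eq: "(\<lambda>i. \<sigma> *\<^sub>R r i) = (\<lambda>i. cnj (q (- i)))" "u = (\<lambda>i. s (1 - i))"
      using chain_cong[OF d' rv _ _ pos, of 0] r0 by simp_all
    have r: "r i = \<sigma> *\<^sub>R cnj (q (- i))" "u i = s (1 - i)" for i
      using eq unfolding \<sigma>\<sigma> by metis+
    \<comment> \<open>If the chain equals its own reversal up to sign, the reversed alternative is
      already covered by the first one.\<close>
    have same: ?thesis if "q = (\<lambda>i. \<tau> *\<^sub>R cnj (q (- i)))" "s = (\<lambda>i. s (1 - i))" "\<tau> \<in> {1, - 1}" for \<tau>
    proof -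
      have "r i = (\<tau> * \<sigma>) *\<^sub>R q i \<and> u i = s i" for i
      proof
        have "q i = \<tau> *\<^sub>R cnj (q (- i))"
          using that(1) by metis
        then show "r i = (\<tau> * \<sigma>) *\<^sub>R q i"
          unfolding r using that(3) by auto
        show "u i = s i"
          unfolding r using that(2) by metis
      qed
      moreover have "\<tau> * \<sigma> \<in> {1, - 1}"
        using that(3) \<sigma> by auto
      ultimately show ?thesis
        by blast
    qed
    have im1: "(Im (q (- 1)))\<^sup>2 = (Im (q 1))\<^sup>2"
      using im[of 1] r(1)[of 1] \<sigma> by auto
    have sh: "chain h g k (\<lambda>i. q (i + 2)) (\<lambda>i. s (i + 2))"
      using chain_shift[OF c] .
    have pp: "0 < s i * s j" for i j
      using chain_same_sign[OF c] .
    consider "q 1 = q (- 1)" | "q 1 = - q (- 1)" | "q 1 = cnj (q (- 1))" | "q 1 = - cnj (q (- 1))"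
      using unit_Im_square[OF chainD(1)[OF c] chainD(1)[OF c] im1] by blast
    then show ?thesis
    proof cases
      case 1
      have "q = (\<lambda>i. q (i + 2))" "s = (\<lambda>i. s (i + 2))"
        using chain_cong[OF c sh _ _ pos, of "- 1"] 1 pp by simp_all
      then have "s 2 = s 0" "q 1 * Complex 1 (s 2) = q 0 * Complex 1 (- s 0)"
        using chainD(3)[OF c, of 1] by (metis add_0, metis add_0 one_add_one)
      then have 2: "q 0 * Complex 1 (- s 0) = q 1 * Complex 1 (s 0)"
        by simp
      have 3: "q 0 * Complex 1 (s 1) = q 1 * Complex 1 (- s 1)"
        using chainD(3)[OF c, of 0] by simp
      have "- s 0 = s 1"
        using tangent_lengths_unique[of "q 0" "- s 0" "q 1" "s 1"] 2 3 chainD(8)[OF c] by simp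
      then have False
        using chainD(7)[OF c, of 0] by simp
      then show ?thesis ..
    next
      case 2
      have "q = (\<lambda>i. - q (i + 2))" "s = (\<lambda>i. s (i + 2))"
        using chain_cong[OF c chain_uminus[OF sh] _ _ pos, of "- 1"] 2 pp by simp_all
      then have "\<forall>i. q (i + 2) = - q i \<and> s (i + 2) = s i"
        by (metis minus_minus)
      then show ?thesis
        using r \<sigma> by blast
    next
      case 3
      have "q = (\<lambda>i. cnj (q (- i)))" "s = (\<lambda>i. s (1 - i))"
        using chain_cong[OF c rv _ _ pos, of 1] 3 pp by simp_all
      then show ?thesis
        using same[of 1] by simp
    next
      case 4
      have "q = (\<lambda>i. - cnj (q (- i)))" "s = (\<lambda>i. s (1 - i))"
        using chain_cong[OF c chain_uminus[OF rv] _ _ pos, of 1] 4 pp by simp_all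
      then show ?thesis
        using same[of "- 1"] by simp
    qed
  qed
qed

text \<open>The vertex abscissa in the hyperbolic picture, up to the factor \<open>h\<close>. Unlike
  \<open>q\<close> itself it is unchanged by \<open>chain_cnj\<close>, so all symmetries act on it
  by a sign.\<close>

definition vtx_re :: "(int \<Rightarrow> complex) \<Rightarrow> (int \<Rightarrow> real) \<Rightarrow> int \<Rightarrow> real" where
  "vtx_re q s i = Re (q i * Complex 1 (- s i))"

text \<open>If the orientations differ, the second chain is first reflected in the principal axis;
  \<open>\<tau>\<close> records this.\<close>

lemma chain_rigid:
  assumes pos: "0 < g" "0 < k" and c: "chain h g k q s" and d: "chain h g k r u"
    and im: "\<And>i. (Im (q i))\<^sup>2 = (Im (r i))\<^sup>2"
  shows "\<exists>\<sigma> \<in> {1, - 1 :: real}. \<exists>\<tau> \<in> {1, - 1}. (\<forall>i. vtx_re r u i = \<sigma> * vtx_re q s i \<and> u i = \<tau> * s i) \<or>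
    (\<forall>i. q (i + 2) = - q i \<and> s (i + 2) = s i) \<and>
    (\<forall>i. vtx_re r u i = \<sigma> * vtx_re q s (1 - i) \<and> u i = \<tau> * s (1 - i))"
proof -
  obtain \<tau> :: real and r' u' where \<tau>: "\<tau> \<in> {1, - 1}" and d': "chain h g k r' u'"
    and r': "\<And>i. vtx_re r u i = vtx_re r' u' i" "\<And>i. u i = \<tau> * u' i"
    and im': "\<And>i. (Im (q i))\<^sup>2 = (Im (r' i))\<^sup>2" and sg: "0 < s 0 * u' 0"
  proof (cases "0 < s 0 * u 0")
    case True
    then show ?thesis
      using that[of 1 r u] d im by simp
  next
    case False
    then have "0 < s 0 * - u 0"
      using chainD(6)[OF c, of 0] chainD(6)[OF d, of 0] by (auto simp: zero_less_mult_iff not_less less_le)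
    then show ?thesis
      using that[of "- 1" "\<lambda>i. cnj (r i)" "\<lambda>i. - u i"] chain_cnj[OF d] im by (simp add: vtx_re_def)
  qed
  obtain \<sigma> where \<sigma>: "\<sigma> \<in> {1, - 1 :: real}" and
    "(\<forall>i. r' i = \<sigma> *\<^sub>R q i \<and> u' i = s i) \<or>
    (\<forall>i. q (i + 2) = - q i \<and> s (i + 2) = s i) \<and> (\<forall>i. r' i = \<sigma> *\<^sub>R cnj (q (- i)) \<and> u' i = s (1 - i))"
    using chain_rigid_oriented[OF pos c d' im' sg] by blast
  then show ?thesis
  proof (elim disjE conjE)
    assume "\<forall>i. r' i = \<sigma> *\<^sub>R q i \<and> u' i = s i"
    then have "vtx_re r u i = \<sigma> * vtx_re q s i \<and> u i = \<tau> * s i" for i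
      unfolding r' by (simp add: vtx_re_def algebra_simps)
    then show ?thesis
      using \<sigma> \<tau> by blast
  next
    assume p: "\<forall>i. q (i + 2) = - q i \<and> s (i + 2) = s i"
      and r: "\<forall>i. r' i = \<sigma> *\<^sub>R cnj (q (- i)) \<and> u' i = s (1 - i)"
    have "vtx_re r u i = \<sigma> * vtx_re q s (1 - i) \<and> u i = \<tau> * s (1 - i)" for i
    proof
      have "vtx_re r' u' i = \<sigma> * Re (q (- i) * Complex 1 (s (1 - i)))"
        using r by (simp add: vtx_re_def algebra_simps)
      also have "q (- i) * Complex 1 (s (1 - i)) = q (1 - i) * Complex 1 (- s (1 - i))"
        using chainD(3)[OF c, of "- i"] by simp
      finally show "vtx_re r u i = \<sigma> * vtx_re q s (1 - i)"
        unfolding r' by (simp only: vtx_re_def)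
      show "u i = \<tau> * s (1 - i)"
        unfolding r' using r by simp
    qed
    then show ?thesis
      using p \<sigma> \<tau> by blast
  qed
qed

lemma hyp_rep_pt: "hyp_rep e h g q s P \<Longrightarrow> P i = pt e (h * vtx_re q s i) (- eps i * g * s i)"
  by (simp add: hyp_rep_def hyp_line_def vtx_re_def)

lemma axis_reflection_pt: "norm (axis_dir e) = 1 \<Longrightarrow> axis_reflection e (pt e x y) = pt e x (- y)"
  by (simp add: axis_reflection_def xc_pt yc_pt) (simp add: pt_def)

lemma half_turn_pt: "half_turn e (pt e x y) = pt e (- x) (- y)"
  by (simp add: half_turn_def pt_def)

lemma sign_change_pt:
  assumes "norm (axis_dir e) = 1" "\<sigma> \<in> {1, - 1}" "\<tau> \<in> {1, - 1}"
  shows "\<exists>g \<in> {id, axis_reflection e}. \<exists>h \<in> {id, half_turn e}. \<forall>x y. g (h (pt e x y)) = pt e (\<sigma> * x) (\<tau> * y)"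
  using assms(2,3) by (auto simp: axis_reflection_pt[OF assms(1)] half_turn_pt)

lemma hyp_rep_rigid:
  assumes f: "hyp_family h g k e c" and c: "chain h g k q s" and P: "hyp_rep e h g q s P"
    and d: "chain h g k r u" and R: "hyp_rep e h g r u R" and iso: "isometric_polygons P R"
  shows "\<exists>\<phi> \<in> {id, axis_reflection e}. \<exists>\<psi> \<in> {id, half_turn e}.
    R = \<phi> \<circ> \<psi> \<circ> P \<or> periodic P 4 \<and> R = \<phi> \<circ> \<psi> \<circ> (\<lambda>i. P (1 - i))"
proof -
  note fD = hyp_familyD[OF f]
  have im: "(Im (q i))\<^sup>2 = (Im (r i))\<^sup>2" for i
  proof (rule chain_lengths[OF fD(1-3) c d])
    have "(dist (P i) (P (i + 1)))\<^sup>2 = (dist (R i) (R (i + 1)))\<^sup>2"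
      using iso by (simp add: isometric_polygons_def)
    then have "(- s i - s (i + 1))\<^sup>2 * dir_square h g (q i) = (- u i - u (i + 1))\<^sup>2 * dir_square h g (r i)"
      unfolding hyp_repD(1,2)[OF c P, of i] hyp_repD(1,2)[OF d R, of i] dist_hyp_line[OF fD(4) eps_cases] .
    moreover have "(- x - y)\<^sup>2 = (x + y)\<^sup>2" for x y :: real
      by (simp add: power2_eq_square algebra_simps)
    ultimately show "(s i + s (i + 1))\<^sup>2 * dir_square h g (q i) = (u i + u (i + 1))\<^sup>2 * dir_square h g (r i)"
      by simp
  qed
  obtain \<sigma> \<tau> where \<sigma>: "\<sigma> \<in> {1, - 1 :: real}" and \<tau>: "\<tau> \<in> {1, - 1 :: real}"
    and alt: "(\<forall>i. vtx_re r u i = \<sigma> * vtx_re q s i \<and> u i = \<tau> * s i) \<or>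
    (\<forall>i. q (i + 2) = - q i \<and> s (i + 2) = s i) \<and>
    (\<forall>i. vtx_re r u i = \<sigma> * vtx_re q s (1 - i) \<and> u i = \<tau> * s (1 - i))"
    using chain_rigid[OF fD(2,3) c d im] by blast
  note sc = sign_change_pt[OF fD(4) \<sigma>]
  from alt show ?thesis
  proof (elim disjE conjE)
    assume a: "\<forall>i. vtx_re r u i = \<sigma> * vtx_re q s i \<and> u i = \<tau> * s i"
    obtain \<phi> \<psi> where g: "\<phi> \<in> {id, axis_reflection e}" "\<psi> \<in> {id, half_turn e}"
      and gh: "\<And>x y. \<phi> (\<psi> (pt e x y)) = pt e (\<sigma> * x) (\<tau> * y)"
      using sc[OF \<tau>] by blast
    have "R = \<phi> \<circ> \<psi> \<circ> P"
      by (rule ext) (simp add: hyp_rep_pt[OF P] hyp_rep_pt[OF R] gh a mult_ac)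
    then show ?thesis
      using g by blast
  next
    assume p: "\<forall>i. q (i + 2) = - q i \<and> s (i + 2) = s i"
      and a: "\<forall>i. vtx_re r u i = \<sigma> * vtx_re q s (1 - i) \<and> u i = \<tau> * s (1 - i)"
    \<comment> \<open>Renumbering by \<open>1 - i\<close> changes the parity of the index, and
      \<open>eps\<close> contributes an extra sign to the ordinates.\<close>
    have "- \<tau> \<in> {1, - 1}"
      using \<tau> by auto
    from sc[OF this] obtain \<phi> \<psi> where g: "\<phi> \<in> {id, axis_reflection e}" "\<psi> \<in> {id, half_turn e}"
      and gh: "\<And>x y. \<phi> (\<psi> (pt e x y)) = pt e (\<sigma> * x) (- \<tau> * y)"
      by blast
    have eps1: "eps (1 - i) = - eps i" for i
      by (simp add: eps_def)
    have "R = \<phi> \<circ> \<psi> \<circ> (\<lambda>i. P (1 - i))"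
      by (rule ext) (simp add: hyp_rep_pt[OF P] hyp_rep_pt[OF R] gh a eps1 mult_ac)
    moreover have "periodic P 4"
    proof -
      have "q (i + 4) = q i" "s (i + 4) = s i" "eps (i + 4) = eps i" for i
        using p[rule_format, of i] p[rule_format, of "i + 2"] by (simp_all add: eps_def add.commute)
      then show ?thesis
        by (simp add: periodic_def hyp_rep_pt[OF P] vtx_re_def)
    qed
    ultimately show ?thesis
      using g by blast
  qed
qed

lemma axis_reflection_hyp_rep:
  assumes f: "hyp_family h g k e c" and c: "chain h g k q s" and P: "hyp_rep e h g q s P"
  shows "hyp_rep e h g (\<lambda>i. cnj (q i)) (\<lambda>i. - s i) (axis_reflection e \<circ> P)"
    "isometric_polygons P (axis_reflection e \<circ> P)" "axis_reflection e \<circ> P \<noteq> P"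
proof -
  note fD = hyp_familyD[OF f]
  show "hyp_rep e h g (\<lambda>i. cnj (q i)) (\<lambda>i. - s i) (axis_reflection e \<circ> P)"
    by (simp add: hyp_rep_def hyp_line_def hyp_rep_pt[OF P] axis_reflection_pt[OF fD(4)] vtx_re_def)
  have "(dist (P i) (P (i + 1)))\<^sup>2 = (dist (axis_reflection e (P i)) (axis_reflection e (P (i + 1))))\<^sup>2" for i
    unfolding hyp_rep_pt[OF P] axis_reflection_pt[OF fD(4)] dist_pt[OF fD(4)]
    by (simp add: power2_eq_square algebra_simps)
  then show "isometric_polygons P (axis_reflection e \<circ> P)"
    by (simp add: isometric_polygons_def power2_eq_iff_nonneg)
  have "axis_reflection e (P 0) \<noteq> P 0"
    unfolding hyp_rep_pt[OF P] axis_reflection_pt[OF fD(4)] pt_eq_iff[OF fD(4)]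
    using fD(2) chainD(6)[OF c, of 0] by simp
  then show "axis_reflection e \<circ> P \<noteq> P"
    by (metis comp_apply)
qed

subsection \<open>Periods\<close>

text \<open>The line is recovered from its two vertices: the difference of consecutive abscissae is
  \<open>Im (q i)\<close> times \<open>s i + s (i + 1)\<close>, and that sum is nonzero.\<close>

lemma chain_vertices_determine:
  assumes c: "chain h g k q s"
    and per: "\<And>i. vtx_re q s (i + m) = vtx_re q s i" "\<And>i. s (i + m) = s i"
  shows "q (i + m) = q i"
proof -
  have 1: "Im (q i) * (s i + s (i + 1)) = vtx_re q s i - vtx_re q s (i + 1)" for i
    unfolding vtx_re_def chainD(3)[OF c, symmetric] by (simp add: algebra_simps)
  have "s i + s (i + 1) \<noteq> 0"
    using chainD(7)[OF c, of i] by simp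
  moreover have "i + m + 1 = i + 1 + m"
    by simp
  then have "Im (q (i + m)) * (s i + s (i + 1)) = Im (q i) * (s i + s (i + 1))"
    unfolding 1[of i] using 1[of "i + m"] per by metis
  ultimately have im: "Im (q (i + m)) = Im (q i)"
    by simp
  then have "Re (q (i + m)) = Re (q i)"
    using per(1)[of i] per(2)[of i] by (simp add: vtx_re_def)
  then show ?thesis
    using im by (simp add: complex_eq_iff)
qed

lemma ell_rep_shift:
  assumes f: "ell_family h g k e c" and ch: "chain h g k q s" and P: "ell_rep e h g q s P"
  shows "(\<forall>i. P (i + m) = P i) \<longleftrightarrow> (\<forall>i. vtx_re q s (i + m) = vtx_re q s i \<and> s (i + m) = s i)"
proof
  assume a: "\<forall>i. P (i + m) = P i"
  show "\<forall>i. vtx_re q s (i + m) = vtx_re q s i \<and> s (i + m) = s i"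
  proof
    fix i
    have e: "q (i + m) * Complex 1 (- s (i + m)) = q i * Complex 1 (- s i)"
      using a[rule_format, of i] unfolding ell_repD(1)[OF ch P] ell_line_inj[OF f] .
    then have "(s (i + m))\<^sup>2 = (s i)\<^sup>2"
      using unit_tangent_square[OF chainD(1)[OF ch], of "i + m" "- s (i + m)"]
        unit_tangent_square[OF chainD(1)[OF ch], of i "- s i"] by simp
    moreover have "s (i + m) \<noteq> - s i"
      using chain_same_sign[OF ch, of "i + m" i] by (auto simp: zero_less_mult_iff)
    ultimately show "vtx_re q s (i + m) = vtx_re q s i \<and> s (i + m) = s i"
      using e by (simp only: vtx_re_def power2_eq_iff) simp
  qed
next
  assume "\<forall>i. vtx_re q s (i + m) = vtx_re q s i \<and> s (i + m) = s i"
  then show "\<forall>i. P (i + m) = P i"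
    using chain_vertices_determine[OF ch] unfolding ell_repD(1)[OF ch P] by simp
qed

lemma eps_shift: "eps (i + int n) = (if even n then eps i else - eps i)"
  by (simp add: eps_def)

text \<open>The ordinate contains \<open>eps i * s i\<close>, so an odd shift of an otherwise
  invariant sequence appears as a reflection. The right-hand side is that of
  \<open>ell_rep_shift\<close>, which makes the periods comparable.\<close>

lemma hyp_rep_shift:
  assumes f: "hyp_family h g k e c" and P: "hyp_rep e h g q s P"
  shows "(\<forall>i. P (i + int n) = (if even n then P i else axis_reflection e (P i))) \<longleftrightarrow>
    (\<forall>i. vtx_re q s (i + int n) = vtx_re q s i \<and> s (i + int n) = s i)"
proof -
  note fD = hyp_familyD[OF f]
  have "P (i + int n) = (if even n then P i else axis_reflection e (P i)) \<longleftrightarrow>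
      vtx_re q s (i + int n) = vtx_re q s i \<and> s (i + int n) = s i" for i
    using fD(1,2)
    by (simp add: hyp_rep_pt[OF P] axis_reflection_pt[OF fD(4)] pt_eq_iff[OF fD(4)] eps_shift)
  then show ?thesis
    by simp
qed

lemma periodic_reps:
  assumes fe: "ell_family h g k e c" and fh: "hyp_family h g k e' c'" and ch: "chain h g k q s"
    and P: "ell_rep e h g q s P" and P': "hyp_rep e' h g q s P'"
  shows "periodic P n \<longleftrightarrow> 0 < n \<and>
      (\<forall>i. P' (i + int n) = (if even n then P' i else axis_reflection e' (P' i)))"
    "periodic P' n \<longleftrightarrow> even n \<and> periodic P n"
proof -
  show 1: "periodic P n \<longleftrightarrow> 0 < n \<and>
      (\<forall>i. P' (i + int n) = (if even n then P' i else axis_reflection e' (P' i)))"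
    unfolding hyp_rep_shift[OF fh P'] periodic_def ell_rep_shift[OF fe ch P] ..
  have "even n" if "periodic P' n"
  proof (rule ccontr)
    \<comment> \<open>An odd period would have to change the sign of \<open>s\<close>, which is
      constant along a chain.\<close>
    assume odd: "odd n"
    have neg: "s (i + int n) = - s i" for i
    proof -
      have "P' (i + int n) = P' i"
        using that by (simp add: periodic_def)
      then have "- eps (i + int n) * g * s (i + int n) = - eps i * g * s i"
        unfolding hyp_rep_pt[OF P'] pt_eq_iff[OF hyp_familyD(4)[OF fh]] by blast
      then have "(eps i * g) * s (i + int n) = (eps i * g) * (- s i)"
        using odd by (simp add: eps_shift)
      then show ?thesis
        using hyp_familyD(2)[OF fh] by (simp only: mult_cancel_left) simp
    qed
    show False
      using chain_same_sign[OF ch, of "0 + int n" 0] unfolding neg by simp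
  qed
  then show "periodic P' n \<longleftrightarrow> even n \<and> periodic P n"
    unfolding 1 by (auto simp: periodic_def)
qed

text \<open>Even periods are common to both polygons, so only an odd period of the elliptic one can
  be shorter. Its double is a period of both, and an odd period exactly half as long as
  \<open>N\<close> is characterised by the reflection condition.\<close>

lemma least_period_reps:
  assumes fe: "ell_family h g k e c" and fh: "hyp_family h g k e' c'" and ch: "chain h g k q s"
    and P: "ell_rep e h g q s P" and P': "hyp_rep e' h g q s P'" and N: "least_period P' N"
  shows "if N mod 4 = 2 \<and> (\<forall>i. P' (i + int (N div 2)) = axis_reflection e' (P' i))
    then least_period P (N div 2) else least_period P N"
proof -
  note per = periodic_reps[OF fe fh ch P P']
  have N': "periodic P' N" "\<And>M. periodic P' M \<Longrightarrow> N \<le> M"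
    using N by (auto simp: least_period_def)
  then have evN: "even N" and perN: "periodic P N"
    using per(2) by auto
  have double: "N \<le> 2 * M" if "periodic P M" for M
  proof -
    have "P (i + int (2 * M)) = P i" for i
    proof -
      have "P (i + int M + int M) = P i"
        using that unfolding periodic_def by metis
      moreover have "i + int (2 * M) = i + int M + int M"
        by simp
      ultimately show ?thesis
        by (simp only:)
    qed
    moreover have "0 < 2 * M"
      using that by (simp add: periodic_def)
    ultimately have "periodic P (2 * M)"
      unfolding periodic_def by blast
    then show ?thesis
      using N'(2) per(2) by simp
  qed
  show ?thesis
  proof (cases "N mod 4 = 2 \<and> (\<forall>i. P' (i + int (N div 2)) = axis_reflection e' (P' i))")
    case True
    then have "N mod 4 = 2"
      by blast
    then have "odd (N div 2)" "0 < N div 2"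
      by presburger+
    then have "periodic P (N div 2)"
      unfolding per(1) using True by simp
    then have "least_period P (N div 2)"
      using double unfolding least_period_def by (metis div_le_mono nonzero_mult_div_cancel_left zero_neq_numeral)
    then show ?thesis
      using True by simp
  next
    case False
    have "N \<le> M" if M: "periodic P M" for M
    proof (cases "even M")
      case True
      then show ?thesis
        using N'(2) per(2) M by blast
    next
      case odd: False
      show ?thesis
      proof (rule ccontr)
        assume lt: "\<not> N \<le> M"
        have "N \<noteq> 2 * M"
        proof
          assume NM: "N = 2 * M"
          then have "N mod 4 = 2" "N div 2 = M"
            using odd by presburger+
          then show False
            using False M odd unfolding per(1) by simp
        qed
        then have gt: "N < 2 * M"
          using double[OF M] by simp
        \<comment> \<open>Were an odd \<open>M\<close> below \<open>N\<close> but not its half,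
          \<open>2 * M - N\<close> would be an even common period shorter than
          \<open>N\<close>.\<close>
        have "P (i + int (2 * M - N)) = P i" for i
        proof -
          have "P (i + int (2 * M - N)) = P (i + int (2 * M - N) + int N)"
            using perN by (simp add: periodic_def)
          also have "i + int (2 * M - N) + int N = i + int M + int M"
            using gt by simp
          also have "P (i + int M + int M) = P i"
            using M unfolding periodic_def by metis
          finally show ?thesis .
        qed
        then have "periodic P (2 * M - N)"
          using gt by (simp add: periodic_def)
        then have "N \<le> 2 * M - N"
          using N'(2) per(2) evN by simp
        then show False
          using lt gt by simp
      qed
    qed
    then have "least_period P N"
      using perN by (simp add: least_period_def)
    then show ?thesis
      using False by auto
  qed
qed

section \<open>Existence of the companion billiards and the final statements\<close>

lemma exists_hyp_family:
  assumes "0 < h" "0 < g" "0 < k"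
  shows "\<exists>e c. hyp_family h g k e c"
proof -
  have "hyp_family h g k \<lparr>centre = 0, axis_dir = 1, sqA = h\<^sup>2 + g\<^sup>2 + k, sqB = k\<rparr>
      \<lparr>centre = 0, axis_dir = 1, sqA = h\<^sup>2, sqB = - g\<^sup>2\<rparr>"
    using assms by (simp add: hyp_family_def aligned_def)
  then show ?thesis
    by blast
qed

lemma exists_ell_family:
  assumes "0 < h" "0 < g" "0 < k"
  shows "\<exists>e c. ell_family h g k e c"
proof -
  have "ell_family h g k \<lparr>centre = 0, axis_dir = 1, sqA = h\<^sup>2 + g\<^sup>2 + k, sqB = g\<^sup>2 + k\<rparr>
      \<lparr>centre = 0, axis_dir = 1, sqA = h\<^sup>2 + g\<^sup>2, sqB = g\<^sup>2\<rparr>"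
    using assms by (simp add: ell_family_def aligned_def)
  then show ?thesis
    by blast
qed

lemma elliptic_to_hyperbolic:
  assumes "elliptic_billiard e c P"
  shows "\<exists>e' c' P'. hyperbolic_billiard e' c' P' \<and> isometric_polygons P P' \<and>
    grid_correspondence P P' \<and> contact_correspondence e c P e' c' P'"
proof -
  obtain h g k where fe: "ell_family h g k e c"
    using elliptic_billiard_family[OF assms] .
  obtain q s where ch: "chain h g k q s" and P: "ell_rep e h g q s P"
    using elliptic_billiardD[OF fe assms] .
  obtain e' c' where fh: "hyp_family h g k e' c'"
    using exists_hyp_family ell_familyD(1-3)[OF fe] by blast
  have P': "hyp_rep e' h g q s (\<lambda>i. hyp_line e' h g (eps i) (q i) (- s i))"
    by (simp add: hyp_rep_def)
  show ?thesis
    using hyperbolic_billiardI[OF fh ch P'] isometric_reps[OF fe fh ch P P']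
      grid_correspondence_reps[OF fe fh ch P P'] contact_correspondence_reps[OF fe fh ch P P']
    by blast
qed

lemma hyperbolic_to_elliptic:
  assumes "hyperbolic_billiard e' c' P'"
  shows "\<exists>e c P. elliptic_billiard e c P \<and> isometric_polygons P P' \<and>
    grid_correspondence P P' \<and> contact_correspondence e c P e' c' P' \<and>
    (\<forall>N. least_period P' N \<longrightarrow>
      (if N mod 4 = 2 \<and> (\<forall>i. P' (i + int (N div 2)) = axis_reflection e' (P' i))
       then least_period P (N div 2) else least_period P N))"
proof -
  obtain h g k where fh: "hyp_family h g k e' c'"
    using hyperbolic_billiard_family[OF assms] .
  obtain q s where ch: "chain h g k q s" and P': "hyp_rep e' h g q s P'"
    using hyperbolic_billiardD[OF fh assms] .
  obtain e c where fe: "ell_family h g k e c"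
    using exists_ell_family hyp_familyD(1-3)[OF fh] by blast
  have P: "ell_rep e h g q s (\<lambda>i. ell_line e h g (q i) (- s i))"
    by (simp add: ell_rep_def)
  show ?thesis
    using elliptic_billiardI[OF fe ch P] isometric_reps[OF fe fh ch P P']
      grid_correspondence_reps[OF fe fh ch P P'] contact_correspondence_reps[OF fe fh ch P P']
      least_period_reps[OF fe fh ch P P']
    by blast
qed

lemma isometric_polygons_trans:
  "isometric_polygons P Q \<Longrightarrow> isometric_polygons Q R \<Longrightarrow> isometric_polygons P R"
  "isometric_polygons P Q \<Longrightarrow> isometric_polygons P R \<Longrightarrow> isometric_polygons Q R"
  by (simp_all add: isometric_polygons_def)

lemma hyperbolic_unique:
  assumes "hyperbolic_billiard e c P" "isometric_polygons P1 P"
  shows "hyperbolic_billiard e c (axis_reflection e \<circ> P)"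
    "isometric_polygons P1 (axis_reflection e \<circ> P)" "axis_reflection e \<circ> P \<noteq> P"
    "hyperbolic_billiard e c R \<Longrightarrow> isometric_polygons P1 R \<Longrightarrow>
      \<exists>g \<in> {id, axis_reflection e}. \<exists>h \<in> {id, half_turn e}.
        R = g \<circ> h \<circ> P \<or> periodic P 4 \<and> R = g \<circ> h \<circ> (\<lambda>i. P (1 - i))"
proof -
  obtain h g k where f: "hyp_family h g k e c"
    using hyperbolic_billiard_family[OF assms(1)] .
  obtain q s where ch: "chain h g k q s" and P: "hyp_rep e h g q s P"
    using hyperbolic_billiardD[OF f assms(1)] .
  note ref = axis_reflection_hyp_rep[OF f ch P]
  show "hyperbolic_billiard e c (axis_reflection e \<circ> P)"
    using hyperbolic_billiardI[OF f chain_cnj[OF ch] ref(1)] .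
  show "isometric_polygons P1 (axis_reflection e \<circ> P)"
    using isometric_polygons_trans(1)[OF assms(2) ref(2)] .
  show "axis_reflection e \<circ> P \<noteq> P"
    using ref(3) .
  assume R: "hyperbolic_billiard e c R" "isometric_polygons P1 R"
  obtain r u where "chain h g k r u" "hyp_rep e h g r u R"
    using hyperbolic_billiardD[OF f R(1)] .
  then show "\<exists>g \<in> {id, axis_reflection e}. \<exists>h \<in> {id, half_turn e}.
        R = g \<circ> h \<circ> P \<or> periodic P 4 \<and> R = g \<circ> h \<circ> (\<lambda>i. P (1 - i))"
    using hyp_rep_rigid[OF f ch P _ _ isometric_polygons_trans(2)[OF assms(2) R(2)]] by blast
qed

theorem theorem1:
  shows
    "(\<forall>e1 c1 P1. elliptic_billiard e1 c1 P1 \<longrightarrow>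
        (\<exists>e2 c2 P2. hyperbolic_billiard e2 c2 P2 \<and> isometric_polygons P1 P2 \<and>
           grid_correspondence P1 P2 \<and> contact_correspondence e1 c1 P1 e2 c2 P2) \<and>
        (\<forall>e2 c2 P2. hyperbolic_billiard e2 c2 P2 \<and> isometric_polygons P1 P2 \<longrightarrow>
           hyperbolic_billiard e2 c2 (axis_reflection e2 \<circ> P2) \<and>
           isometric_polygons P1 (axis_reflection e2 \<circ> P2) \<and>
           axis_reflection e2 \<circ> P2 \<noteq> P2 \<and>
           (\<forall>R2. hyperbolic_billiard e2 c2 R2 \<and> isometric_polygons P1 R2 \<longrightarrow>
              (\<exists>g \<in> {id, axis_reflection e2}. \<exists>h \<in> {id, half_turn e2}.
                 R2 = g \<circ> h \<circ> P2 \<or>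
                 periodic P2 4 \<and> R2 = g \<circ> h \<circ> (\<lambda>i. P2 (1 - i))))))
     \<and>
     (\<forall>e2 c2 P2. hyperbolic_billiard e2 c2 P2 \<longrightarrow>
        (\<exists>e1 c1 P1. elliptic_billiard e1 c1 P1 \<and> isometric_polygons P1 P2 \<and>
           grid_correspondence P1 P2 \<and> contact_correspondence e1 c1 P1 e2 c2 P2 \<and>
           (\<forall>N. least_period P2 N \<longrightarrow>
              (if N mod 4 = 2 \<and> (\<forall>i. P2 (i + int (N div 2)) = axis_reflection e2 (P2 i))
               then least_period P1 (N div 2)
               else least_period P1 N))))"
  by (intro conjI allI impI; (elim conjE)?)
    (rule elliptic_to_hyperbolic hyperbolic_unique hyperbolic_to_elliptic, assumption+)+

end
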